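(* Let $d\geq 2$ be an integer and let $\psi:\mathbb{N}\to[0,\infty)$ be a non-increasing function such that $\sum_{q\in\mathbb{N}}\psi(q)^d$ converges. For $x\in\mathbb{R}$, let $N(x)$ denote the statement: the set of $(x_2,\dots,x_d)\in\mathbb{R}^{d-1}$ with $(x,x_2,\dots,x_d)\in\mathcal{W}_d(\psi)$ has $(d-1)$-dimensional Lebesgue measure zero. Then: (a) If $\sum_{q\in\mathbb{N}}\psi(q)^{d-1}$ diverges, then $N(x)$ holds for no $x\in\mathbb{Q}$; if $\sum_{q\in\mathbb{N}}\psi(q)^{d-1}$ converges, then $N(x)$ holds for every $x\in\mathbb{R}$. (b) $N(x)$ holds for every $x\in\mathbb{R}\setminus\mathbb{Q}$ with the bounded ratio property. The irrational numbers with the bounded ratio property include: - every $x$ of Diophantine type less than $\varphi=\frac{1+\sqrt5}{2}$; - every $x$ of Diophantine type less than $2$ for which there exists $R\ge1$ such that $q_{k_m}\ge 2q_{k_{m-1}+1}$ for all but finitely many $m$ (i.e. eventually, whenever a partial quotient of $x$ exceeds $R$, the continuants at least double before the next partial quotient exceeding $R$).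
   Context: For $\psi:\mathbb{N}\to[0,\infty)$, $\mathcal{W}_d(\psi)$ is the set of $\boldsymbol{x}\in\mathbb{R}^d$ such that $\|q\boldsymbol{x}-\boldsymbol{p}\|_\infty<\psi(q)$ holds for infinitely many $(\boldsymbol{p},q)\in\mathbb{Z}^d\times\mathbb{N}$. For $\tau>0$ write $\mathcal{W}_1(\tau)=\mathcal{W}_1(q\mapsto q^{-\tau})$. The Diophantine type of $x\in\mathbb{R}$ is the supremum (in $(0,\infty]$) of all $\tau>0$ with $x\in\mathcal{W}_1(\tau)$ (so rational numbers have Diophantine type $\infty$). For irrational $x=[a_0;a_1,a_2,\dots]$ (simple continued fraction, with partial quotients $a_k$), the continuants are $q_{-1}=0$, $q_0=1$, $q_k=a_kq_{k-1}+q_{k-2}$. Given an integer $R\ge1$, put $k_0=-1$ and let $k_1<k_2<\cdots$ be the (finite or infinite) increasing list of all indices $k\ge0$ with $a_{k+1}>R$. For $m\ge0$ define the block $B_{m+1}=[\,q_{k_m+1}-Rq_{k_m},\;q_{k_{m+1}}\,]\cap\mathbb{N}$; if the list ends with $k_t$, then $B_{t+1}=[\,q_{k_t+1}-Rq_{k_t},\infty)\cap\mathbb{N}$ is the last block. Put $B_{m+1}-B_m:=\min B_{m+1}-\max B_m=q_{k_m+1}-(R+1)q_{k_m}$, and let $\Sigma_{\omega_m}$ be the sum of all elements of the blocks $B_1,\dots,B_m$ (summed block by block). The number $x$ has the bounded ratio property if there is $R\ge1$ such that $\sum_{m\ge1}\frac{B_{m+1}-B_m}{\Sigma_{\omega_m}}<\infty$.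 If the list $\{k_m\}$ is finite, the sum is finite and the condition is regarded as satisfied; likewise conditions on all but finitely many $m$ are then vacuous. *)

theory Defs
  imports "HOL-Analysis.Analysis"
begin

section \<open>Simultaneously approximable points\<close>

text \<open>
  The coordinates of a Euclidean space are taken with respect to its standard basis, so that
  one definition serves \<open>\<real>\<close> (for \<open>d = 1\<close>) and \<open>\<real> \<times> \<real>\<^bsup>d-1\<^esup>\<close>, whose points are written
  \<open>(x, y)\<close> with \<open>y = (x\<^sub>2, \<dots>, x\<^sub>d)\<close>.
\<close>

definition int_points :: "'a::euclidean_space set" where
  "int_points = {p. \<forall>b\<in>Basis. p \<bullet> b \<in> \<int>}"

text \<open>Denominators are positive, so the value of \<open>\<psi>\<close> at \<open>0\<close> plays no role.\<close>

definition approximable :: "(nat \<Rightarrow> real) \<Rightarrow> 'a::euclidean_space set" where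
  "approximable \<psi> =
    {x. infinite {(p, q). p \<in> int_points \<and> q \<ge> 1 \<and> infnorm (real q *\<^sub>R x - p) < \<psi> q}}"

definition diophantine_type :: "real \<Rightarrow> ereal" where
  "diophantine_type x =
    Sup {ereal \<tau> | \<tau>. \<tau> > 0 \<and> x \<in> approximable (\<lambda>q. real q powr (-\<tau>))}"


section \<open>Simple continued fractions\<close>

text \<open>All notions in this and the next section are meant for irrational \<open>x\<close>.\<close>

fun complete_quotient :: "real \<Rightarrow> nat \<Rightarrow> real" where
  "complete_quotient x 0 = x"
| "complete_quotient x (Suc k) = 1 / frac (complete_quotient x k)"

definition partial_quotient :: "real \<Rightarrow> nat \<Rightarrow> int" where
  "partial_quotient x k = \<lfloor>complete_quotient x k\<rfloor>"

text \<open>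
  Continuants are indexed from \<open>-1\<close>; the auxiliary function is shifted by one, i.e.
  \<open>continuant_aux x n\<close> is the continuant of index \<open>n - 1\<close>.
\<close>

fun continuant_aux :: "real \<Rightarrow> nat \<Rightarrow> int" where
  "continuant_aux x 0 = 0"
| "continuant_aux x (Suc 0) = 1"
| "continuant_aux x (Suc (Suc n)) =
     partial_quotient x (Suc n) * continuant_aux x (Suc n) + continuant_aux x n"

definition continuant :: "real \<Rightarrow> int \<Rightarrow> int" where
  "continuant x k = continuant_aux x (nat (k + 1))"


section \<open>Blocks and the bounded ratio property\<close>

definition large_indices :: "real \<Rightarrow> nat \<Rightarrow> nat set" where
  "large_indices x R = {k. partial_quotient x (Suc k) > int R}"

text \<open>
  For \<open>m \<ge> 1\<close> the index \<open>k\<^sub>m\<close> is the \<open>m\<close>-th smallest element of \<^const>\<open>large_indices\<close>. If that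
  set is finite, \<open>k\<^sub>m\<close> exists only for \<open>m\<close> up to its cardinality, and the value of
  \<^const>\<open>enumerate\<close> beyond it is meaningless.
\<close>

definition large_index :: "real \<Rightarrow> nat \<Rightarrow> nat \<Rightarrow> int" where
  "large_index x R m = (if m = 0 then -1 else int (enumerate (large_indices x R) (m - 1)))"

text \<open>
  The block \<open>B\<^sub>m\<close>, for \<open>m \<ge> 1\<close>; it is unbounded if \<open>k\<^sub>m\<close> does not exist.
\<close>

definition block :: "real \<Rightarrow> nat \<Rightarrow> nat \<Rightarrow> nat set" where
  "block x R m =
    {n. n \<ge> 1 \<and>
        continuant x (large_index x R (m - 1) + 1)
          - int R * continuant x (large_index x R (m - 1)) \<le> int n \<and>
        ((finite (large_indices x R) \<longrightarrow> m \<le> card (large_indices x R))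
          \<longrightarrow> int n \<le> continuant x (large_index x R m))}"

text \<open>
  The gap \<open>B\<^sub>m\<^sub>+\<^sub>1 - B\<^sub>m\<close>. The infimum is the minimum; it is used because \<^const>\<open>Min\<close> is
  unspecified on the infinite last block.
\<close>

definition block_gap :: "real \<Rightarrow> nat \<Rightarrow> nat \<Rightarrow> int" where
  "block_gap x R m = int (Inf (block x R (m + 1))) - int (Max (block x R m))"

text \<open>Consecutive blocks may share an endpoint, which is then counted twice.\<close>

definition block_sum :: "real \<Rightarrow> nat \<Rightarrow> nat \<Rightarrow> nat" where
  "block_sum x R m = (\<Sum>i=1..m. \<Sum>n\<in>block x R i. n)"

definition bounded_ratio :: "real \<Rightarrow> bool" where
  "bounded_ratio x \<longleftrightarrow>
    (\<exists>R\<ge>1. infinite (large_indices x R) \<longrightarrow>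
      summable (\<lambda>m. real_of_int (block_gap x R (Suc m)) / real (block_sum x R (Suc m))))"

end

theory Submission
  imports Defs "HOL-Number_Theory.Totient"
begin

text \<open>
  By Borel--Cantelli, \<open>N(x)\<close> holds as soon as the sum of \<open>\<psi>(q)\<^bsup>d-1\<^esup>\<close> over those \<open>q\<close> for which
  \<open>q x\<close> is within \<open>\<psi>(q)\<close> of an integer converges. For irrational \<open>x\<close>, cut \<open>[q\<^sub>k, q\<^sub>k\<^sub>+\<^sub>1)\<close> into windows of
  length \<open>q\<^sub>k\<close>. In a window starting at \<open>N\<close> the numbers \<open>q x\<close> are, up to a common shift and modulo 1,
  close to distinct multiples of \<open>1/q\<^sub>k\<close>, so at most \<open>2 q\<^sub>k \<psi>(N) + 3\<close> of the \<open>q\<close> count.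
  The windows together contribute a constant times \<open>\<Sum>\<psi>\<^bsup>d\<^esup>\<close>, up to an error of order \<open>q\<^sub>k\<^sub>+\<^sub>1/q\<^sub>k\<^sup>2\<close>. Since the blocks up to \<open>B\<^sub>m\<close> have a sum of order at
  most \<open>q\<^sub>k\<^sup>2\<close> with \<open>k = k\<^sub>m\<close>, the bounded ratio property makes these errors summable.

  For rational \<open>x\<close> with denominator \<open>b\<close> only multiples of \<open>b\<close> are used, which reduces the claim to the
  divergence part of Khintchine's theorem in dimension \<open>d - 1\<close>. It is proved by a second moment argument
  for neighbourhoods of reduced fractions; in dimension \<open>d - 1\<close> these are taken coordinatewise, so
  that measures and overlaps are powers of the one-dimensional ones. Positive measure suffices, hence no
  zero-one law is needed.

  The two sufficient conditions for bounded ratio follow from \<open>q\<^sub>k\<^sub>+\<^sub>1 \<le> q\<^sub>k\<^bsup>\<tau>\<^esup>\<close> together with a lower bound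
  for the sum of the single block \<open>B\<^sub>m\<close>.
\<close>

section \<open>Convergents\<close>

text \<open>\<open>conv_num x n\<close> is the numerator of the convergent of index n - 1, in line
  with the shift of \<open>continuant_aux\<close>.\<close>

fun conv_num :: "real \<Rightarrow> nat \<Rightarrow> int" where
  "conv_num x 0 = 1"
| "conv_num x (Suc 0) = \<lfloor>x\<rfloor>"
| "conv_num x (Suc (Suc n)) =
     partial_quotient x (Suc n) * conv_num x (Suc n) + conv_num x n"

lemma irrational_complete_quotient:
  assumes "x \<notin> \<rat>"
  shows "complete_quotient x n \<notin> \<rat>"
proof (induction n)
  case (Suc n)
  have "frac (complete_quotient x n) \<notin> \<rat>"
    using Suc Rats_add[of "frac (complete_quotient x n)" "of_int \<lfloor>complete_quotient x n\<rfloor>"]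
    by (auto simp: frac_def)
  then have "inverse (frac (complete_quotient x n)) \<notin> \<rat>"
    using Rats_inverse by fastforce
  then show ?case by (simp add: inverse_eq_divide)
qed (use assms in simp)

lemma frac_complete_quotient_pos:
  assumes "x \<notin> \<rat>"
  shows "frac (complete_quotient x n) > 0"
  using irrational_complete_quotient[OF assms, of n] Ints_subset_Rats
  by (auto simp: frac_gt_0_iff)

lemma complete_quotient_Suc_gt_1:
  assumes "x \<notin> \<rat>"
  shows "complete_quotient x (Suc n) > 1"
  using frac_complete_quotient_pos[OF assms, of n] frac_lt_1[of "complete_quotient x n"]
  by simp

lemma partial_quotient_Suc_ge_1:
  assumes "x \<notin> \<rat>"
  shows "partial_quotient x (Suc n) \<ge> 1"
  using complete_quotient_Suc_gt_1[OF assms, of n] unfolding partial_quotient_def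
  by linarith


section \<open>Growth of the continuants\<close>

lemma continuant_aux_Suc_ge_1:
  assumes "x \<notin> \<rat>"
  shows "continuant_aux x (Suc n) \<ge> 1"
proof -
  have "continuant_aux x n \<ge> 0 \<and> continuant_aux x (Suc n) \<ge> 1"
  proof (induction n)
    case (Suc n)
    then show ?case
      using mult_mono[of 1 "partial_quotient x (Suc n)" 1 "continuant_aux x (Suc n)"]
        partial_quotient_Suc_ge_1[OF assms, of n]
      by simp
  qed simp
  then show ?thesis by simp
qed

lemma continuant_aux_add_le:
  assumes "x \<notin> \<rat>"
  shows "continuant_aux x (Suc n) + continuant_aux x n \<le> continuant_aux x (Suc (Suc n))"
  using mult_right_mono[of 1 "partial_quotient x (Suc n)" "continuant_aux x (Suc n)"]
    partial_quotient_Suc_ge_1[OF assms, of n] continuant_aux_Suc_ge_1[OF assms, of n]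
  by simp

lemma continuant_aux_nonneg:
  assumes "x \<notin> \<rat>"
  shows "continuant_aux x n \<ge> 0"
  using continuant_aux_Suc_ge_1[OF assms, of "n - 1"] by (cases n) simp_all

lemma mono_continuant_aux:
  assumes "x \<notin> \<rat>"
  shows "mono (continuant_aux x)"
proof (rule incseq_SucI)
  fix n
  show "continuant_aux x n \<le> continuant_aux x (Suc n)"
    using continuant_aux_add_le[OF assms, of "n - 1"] continuant_aux_nonneg[OF assms, of "n - 1"]
    by (cases n) simp_all
qed

text \<open>All geometric growth below comes from this doubling over two steps; a single step gives
  no such factor, as the partial quotient may be 1.\<close>

lemma continuant_aux_double:
  assumes "x \<notin> \<rat>"
  shows "2 * continuant_aux x n \<le> continuant_aux x (Suc (Suc n))"
  using continuant_aux_add_le[OF assms, of n] monoD[OF mono_continuant_aux[OF assms], of n "Suc n"]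
  by simp

lemma continuant_aux_Suc_ge:
  assumes "x \<notin> \<rat>"
  shows "int n \<le> continuant_aux x (Suc n)"
proof (induction n)
  case (Suc n)
  show ?case
  proof (cases n)
    case 0
    then show ?thesis using continuant_aux_Suc_ge_1[OF assms, of 1] by simp
  next
    case (Suc k)
    have "continuant_aux x (Suc n) + 1 \<le> continuant_aux x (Suc (Suc n))"
      using continuant_aux_add_le[OF assms, of n] continuant_aux_Suc_ge_1[OF assms, of k]
      unfolding Suc by linarith
    with \<open>int n \<le> continuant_aux x (Suc n)\<close> show ?thesis by linarith
  qed
qed simp

text \<open>Two-step doubling amounts to a factor sqrt 2 per step; the constant 2 absorbs the start
  of the odd indices.\<close>

lemma continuant_aux_growth:
  assumes "x \<notin> \<rat>"
  shows "sqrt 2 ^ n \<le> 2 * real_of_int (continuant_aux x (Suc n))"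
proof (induction n rule: nat_induct2)
  case 1
  have "sqrt 2 \<le> 2" by (rule real_le_lsqrt) auto
  then show ?case using continuant_aux_Suc_ge_1[OF assms, of 1] by simp
next
  case (step n)
  have "2 * real_of_int (continuant_aux x (Suc n)) \<le> continuant_aux x (Suc (Suc (Suc n)))"
    using continuant_aux_double[OF assms, of "Suc n"] by linarith
  moreover have "sqrt 2 ^ (n + 2) = 2 * sqrt 2 ^ n" by (simp add: power_add)
  ultimately show ?case using step unfolding add_2_eq_Suc' by linarith
qed simp

lemma summable_continuant_aux_powr:
  assumes "x \<notin> \<rat>" "e > 0"
  shows "summable (\<lambda>n. real_of_int (continuant_aux x (Suc n)) powr (- e))"
proof (rule summable_comparison_test')
  have "(sqrt 2 powr (- e)) < 1"
    using assms(2) by (simp add: powr_less_one)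
  then show "summable (\<lambda>n. 2 powr e * (sqrt 2 powr (- e)) ^ n)"
    by (intro summable_mult summable_geometric) simp
  fix n :: nat
  have 1: "real_of_int (continuant_aux x (Suc n)) \<ge> 1"
    using continuant_aux_Suc_ge_1[OF assms(1), of n] by simp
  have "real_of_int (continuant_aux x (Suc n)) powr (- e) \<le> (sqrt 2 ^ n / 2) powr (- e)"
    using assms(2) continuant_aux_growth[OF assms(1), of n]
    by (intro powr_mono2') auto
  also have "\<dots> = 2 powr e * (sqrt 2 powr (- e)) ^ n"
    by (simp add: powr_divide powr_minus powr_powr powr_power divide_simps mult_ac flip: powr_realpow)
  finally show "norm (real_of_int (continuant_aux x (Suc n)) powr (- e)) \<le>
     2 powr e * (sqrt 2 powr (- e)) ^ n"
    by simp
qed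

section \<open>Approximation errors of the convergents\<close>

definition conv_err :: "real \<Rightarrow> nat \<Rightarrow> real" where
  "conv_err x n = of_int (continuant_aux x n) * x - of_int (conv_num x n)"

text \<open>The errors obey the recursion of the continuants, and a complete quotient differs from
  its partial quotient by its fractional part, the inverse of the next complete quotient.\<close>

lemma conv_err_Suc:
  assumes "x \<notin> \<rat>"
  shows "complete_quotient x (Suc n) * conv_err x (Suc n) = - conv_err x n"
proof (induction n)
  case 0
  then show ?case
    using frac_complete_quotient_pos[OF assms, of 0]
    by (simp add: conv_err_def frac_def)
next
  case (Suc n)
  let ?\<alpha> = "complete_quotient x (Suc n)"
  have pos: "frac ?\<alpha> > 0" by (rule frac_complete_quotient_pos[OF assms])
  have "conv_err x (Suc (Suc n)) = of_int (partial_quotient x (Suc n)) * conv_err x (Suc n) + conv_err x n"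
    by (simp add: conv_err_def algebra_simps)
  also have "conv_err x n = - ?\<alpha> * conv_err x (Suc n)" using Suc by simp
  also have "of_int (partial_quotient x (Suc n)) * conv_err x (Suc n) + - ?\<alpha> * conv_err x (Suc n)
     = - frac ?\<alpha> * conv_err x (Suc n)"
    unfolding partial_quotient_def frac_def by algebra
  finally show ?case using pos by simp
qed

text \<open>The recursion flips the sign of the determinant at every step and preserves its absolute
  value.\<close>

lemma conv_det:
  "\<bar>conv_num x n * continuant_aux x (Suc n) - conv_num x (Suc n) * continuant_aux x n\<bar> = 1"
proof (induction n)
  case (Suc n)
  have "conv_num x (Suc n) * continuant_aux x (Suc (Suc n)) - conv_num x (Suc (Suc n)) * continuant_aux x (Suc n)
    = - (conv_num x n * continuant_aux x (Suc n) - conv_num x (Suc n) * continuant_aux x n)"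
    by (simp add: algebra_simps)
  then show ?case using Suc by simp
qed simp

lemma coprime_conv: "coprime (conv_num x n) (continuant_aux x n)"
proof (rule coprimeI)
  fix c assume "c dvd conv_num x n" "c dvd continuant_aux x n"
  then have "c dvd conv_num x n * continuant_aux x (Suc n) - conv_num x (Suc n) * continuant_aux x n"
    by simp
  then show "is_unit c"
    using conv_det[of x n] by (metis dvd_abs_iff)
qed

text \<open>With the complete quotient \<alpha> in place of the partial quotient, the next
  continuant can only grow. By \<open>conv_err_Suc\<close>, the error times this larger number is
  the determinant of absolute value 1.\<close>

lemma conv_err_bound:
  assumes "x \<notin> \<rat>"
  shows "\<bar>conv_err x (Suc n)\<bar> * of_int (continuant_aux x (Suc (Suc n))) \<le> 1"
proof -
  let ?\<alpha> = "complete_quotient x (Suc n)" and ?D = "conv_err x" and ?Q = "\<lambda>n. real_of_int (continuant_aux x n)"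
  have "?Q (Suc (Suc n)) = of_int (partial_quotient x (Suc n)) * ?Q (Suc n) + ?Q n"
    by simp
  also have "\<dots> \<le> ?\<alpha> * ?Q (Suc n) + ?Q n"
    using continuant_aux_nonneg[OF assms, of "Suc n"]
    by (intro add_right_mono mult_right_mono) (simp_all add: partial_quotient_def)
  finally have "\<bar>?D (Suc n)\<bar> * ?Q (Suc (Suc n)) \<le> \<bar>?D (Suc n)\<bar> * (?\<alpha> * ?Q (Suc n) + ?Q n)"
    by (intro mult_left_mono) auto
  also have "\<dots> = \<bar>?D (Suc n) * (?\<alpha> * ?Q (Suc n) + ?Q n)\<bar>"
    using complete_quotient_Suc_gt_1[OF assms, of n] continuant_aux_nonneg[OF assms, of n]
      continuant_aux_nonneg[OF assms, of "Suc n"]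
    by (subst abs_mult) (auto simp del: complete_quotient.simps)
  also have "?D (Suc n) * (?\<alpha> * ?Q (Suc n) + ?Q n) = - ?D n * ?Q (Suc n) + ?D (Suc n) * ?Q n"
    unfolding conv_err_Suc[OF assms, of n, symmetric] by (simp add: algebra_simps)
  also have "\<dots> = of_int (conv_num x n * continuant_aux x (Suc n) - conv_num x (Suc n) * continuant_aux x n)"
    unfolding conv_err_def by (simp add: algebra_simps)
  finally show ?thesis using conv_det[of x n] by linarith
qed


section \<open>Convergence: a Borel--Cantelli argument\<close>

definition near_int :: "real \<Rightarrow> real \<Rightarrow> bool" where
  "near_int r t \<longleftrightarrow> (\<exists>p::int. \<bar>t - of_int p\<bar> < r)"

lemma infnorm_less_iff: "infnorm (x::'a::euclidean_space) < r \<longleftrightarrow> (\<forall>b\<in>Basis. \<bar>x \<bullet> b\<bar> < r)"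
  by (simp add: infnorm_Max)

text \<open>The supremum norm decouples the coordinates, so an integer point is assembled from
  independent choices.\<close>

lemma ex_int_point_near:
  fixes z :: "'a::euclidean_space"
  shows "(\<exists>p\<in>int_points. infnorm (z - p) < r) \<longleftrightarrow> (\<forall>b\<in>Basis. near_int r (z \<bullet> b))"
proof
  assume "\<exists>p\<in>int_points. infnorm (z - p) < r"
  then obtain p where p: "p \<in> int_points" "\<forall>b\<in>Basis. \<bar>(z - p) \<bullet> b\<bar> < r"
    by (auto simp: infnorm_less_iff)
  show "\<forall>b\<in>Basis. near_int r (z \<bullet> b)"
  proof
    fix b :: 'a assume b: "b \<in> Basis"
    then obtain m where "p \<bullet> b = of_int m"
      using p unfolding int_points_def by (blast elim: Ints_cases)
    then show "near_int r (z \<bullet> b)"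
      using p(2) b unfolding near_int_def by (metis inner_diff_left)
  qed
next
  assume "\<forall>b\<in>Basis. near_int r (z \<bullet> b)"
  then obtain f :: "'a \<Rightarrow> int" where f: "\<And>b. b \<in> Basis \<Longrightarrow> \<bar>z \<bullet> b - of_int (f b)\<bar> < r"
    unfolding near_int_def by metis
  let ?p = "\<Sum>b\<in>Basis. real_of_int (f b) *\<^sub>R b"
  have "?p \<in> int_points" by (simp add: int_points_def)
  moreover have "infnorm (z - ?p) < r"
    using f by (simp add: infnorm_less_iff inner_diff_left)
  ultimately show "\<exists>p\<in>int_points. infnorm (z - p) < r" by blast
qed

text \<open>Finite fibres over each q turn infinitely many pairs (p, q) into infinitely many
  q.\<close>

lemma finite_int_points_near:
  fixes z :: "'a::euclidean_space"
  shows "finite {p \<in> int_points. infnorm (z - p) < r}"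
proof (rule finite_subset)
  have "finite {t \<in> \<int>. \<bar>c - t\<bar> < r}" for c :: real
  proof (rule finite_subset)
    show "{t \<in> \<int>. \<bar>c - t\<bar> < r} \<subseteq> of_int ` {\<lfloor>c - r\<rfloor>..\<lceil>c + r\<rceil>}"
      by (auto elim!: Ints_cases intro!: imageI) linarith+
  qed simp
  then show "finite ((\<lambda>f. \<Sum>b\<in>Basis. f b *\<^sub>R b) ` (\<Pi>\<^sub>E b\<in>Basis. {t \<in> \<int>. \<bar>z \<bullet> b - t\<bar> < r}))"
    by (intro finite_imageI finite_PiE) auto
  show "{p \<in> int_points. infnorm (z - p) < r} \<subseteq>
    (\<lambda>f. \<Sum>b\<in>Basis. f b *\<^sub>R b) ` (\<Pi>\<^sub>E b\<in>Basis. {t \<in> \<int>. \<bar>z \<bullet> b - t\<bar> < r})"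
  proof
    fix p assume "p \<in> {p \<in> int_points. infnorm (z - p) < r}"
    then show "p \<in> (\<lambda>f. \<Sum>b\<in>Basis. f b *\<^sub>R b) ` (\<Pi>\<^sub>E b\<in>Basis. {t \<in> \<int>. \<bar>z \<bullet> b - t\<bar> < r})"
      by (intro image_eqI[where x = "\<lambda>b\<in>Basis. p \<bullet> b"])
        (auto simp: euclidean_representation int_points_def infnorm_less_iff inner_diff_left)
  qed
qed

lemma approximable_iff:
  fixes x :: "'a::euclidean_space"
  shows "x \<in> approximable \<psi> \<longleftrightarrow>
    infinite {q. q \<ge> 1 \<and> (\<forall>b\<in>Basis. near_int (\<psi> q) (real q * (x \<bullet> b)))}"
    (is "_ \<longleftrightarrow> infinite ?T")
proof -
  let ?S = "{(p, q). p \<in> int_points \<and> q \<ge> 1 \<and> infnorm (real q *\<^sub>R x - p) < \<psi> q}"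
  have near: "(\<forall>b\<in>Basis. near_int (\<psi> q) (real q * (x \<bullet> b))) \<longleftrightarrow>
      (\<exists>p\<in>int_points. infnorm (real q *\<^sub>R x - p) < \<psi> q)" for q
    using ex_int_point_near[of "real q *\<^sub>R x" "\<psi> q"] by simp
  have "?T = snd ` ?S"
    unfolding near by (auto simp: image_iff)
  then have fin1: "finite ?S \<Longrightarrow> finite ?T" by simp
  have "?S \<subseteq> prod.swap ` (SIGMA q:?T. {p \<in> int_points. infnorm (real q *\<^sub>R x - p) < \<psi> q})"
    unfolding near by (auto simp: image_iff)
  then have "finite ?T \<Longrightarrow> finite ?S"
    by (rule finite_subset) (intro finite_imageI finite_SigmaI finite_int_points_near)
  with fin1 show ?thesis unfolding approximable_def mem_Collect_eq by blast
qed

lemma approximable_Pair_iff: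
  fixes x :: real and y :: "'a::euclidean_space"
  shows "(x, y) \<in> approximable \<psi> \<longleftrightarrow>
    infinite {q. q \<ge> 1 \<and> near_int (\<psi> q) (real q * x) \<and> (\<forall>b\<in>Basis. near_int (\<psi> q) (real q * (y \<bullet> b)))}"
  unfolding approximable_iff by (simp add: Basis_prod_def ball_Un)

text \<open>Lebesgue measure is the image of the product of one-dimensional measures under the
  coordinate map, and the preimage of the cube is a product set.\<close>

lemma
  fixes A :: "real set"
  assumes A: "A \<in> sets borel"
  shows sets_borel_cube: "{y::'a::euclidean_space. \<forall>b\<in>Basis. y \<bullet> b \<in> A} \<in> sets borel" (is ?th1)
    and emeasure_lborel_cube:
      "emeasure lborel {y::'a. \<forall>b\<in>Basis. y \<bullet> b \<in> A} = emeasure lborel A ^ DIM('a)" (is ?th2)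
proof -
  interpret product_sigma_finite "\<lambda>_::'a. lborel :: real measure" by standard
  let ?C = "{y::'a. \<forall>b\<in>Basis. y \<bullet> b \<in> A}"
  note A[measurable]
  show 1: ?th1 by measurable
  have "emeasure lborel ?C = emeasure (distr (\<Pi>\<^sub>M b\<in>Basis. lborel) borel (\<lambda>f. \<Sum>b\<in>Basis. f b *\<^sub>R b :: 'a)) ?C"
    by (subst lborel_eq) simp
  also have "\<dots> = emeasure (\<Pi>\<^sub>M b\<in>(Basis::'a set). lborel) (\<Pi>\<^sub>E b\<in>Basis. A)"
  proof (subst emeasure_distr)
    have "((\<lambda>f. \<Sum>b\<in>Basis. f b *\<^sub>R b :: 'a) -` ?C \<inter> space (\<Pi>\<^sub>M b\<in>(Basis::'a set). lborel))
      = (\<Pi>\<^sub>E b\<in>Basis. A)"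
      by (auto simp: space_PiM PiE_iff)
    then show "emeasure (\<Pi>\<^sub>M b\<in>(Basis::'a set). lborel)
      ((\<lambda>f. \<Sum>b\<in>Basis. f b *\<^sub>R b :: 'a) -` ?C \<inter> space (\<Pi>\<^sub>M b\<in>(Basis::'a set). lborel))
      = emeasure (\<Pi>\<^sub>M b\<in>(Basis::'a set). lborel) (\<Pi>\<^sub>E b\<in>Basis. A)" by simp
  qed (use 1 in measurable)
  also have "\<dots> = emeasure lborel A ^ DIM('a)"
    by (subst emeasure_PiM) (use A in auto)
  finally show ?th2 .
qed

lemma open_near_int: "open {t. near_int r (c * t)}"
proof -
  have "{t. near_int r (c * t)} = (\<Union>p::int. {t. \<bar>c * t - of_int p\<bar> < r})"
    by (auto simp: near_int_def)
  then show ?thesis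
    by (auto intro!: open_Collect_less continuous_intros)
qed

text \<open>For r < 1 at most 2 M q + 3 integers p come into question, each with an interval of
  length 2 r / q. For r \<ge> 1 the bound exceeds the length of the whole range.\<close>

lemma emeasure_near_int_le:
  assumes "q \<ge> 1" "r \<ge> 0"
  shows "emeasure lborel {t \<in> {-real M..real M}. near_int r (real q * t)} \<le> ennreal ((2 * real M + 3) * (2 * r))"
    (is "emeasure lborel ?T \<le> _")
proof (cases "r \<ge> 1")
  case True
  have "emeasure lborel ?T \<le> emeasure lborel {-real M..real M}"
    by (rule emeasure_mono) auto
  also have "\<dots> = ennreal (2 * M)" by simp
  also have "\<dots> \<le> ennreal ((2 * real M + 3) * (2 * r))"
    using True mult_mono[of "2 * real M" "2 * real M + 3" 1 "2 * r"] by (intro ennreal_leI) auto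
  finally show ?thesis .
next
  case False
  let ?P = "{- int (M * q + 1)..int (M * q + 1)}"
  let ?I = "\<lambda>p::int. {(of_int p - r) / q..(of_int p + r) / q}"
  have "?T \<subseteq> (\<Union>p\<in>?P. ?I p)"
  proof
    fix t assume t: "t \<in> ?T"
    then obtain p :: int where p: "\<bar>real q * t - of_int p\<bar> < r" by (auto simp: near_int_def)
    have "\<bar>real q * t\<bar> \<le> real q * real M"
      using t by (auto simp: abs_mult intro!: mult_left_mono)
    with p False have "\<bar>real_of_int p\<bar> < of_int (int (M * q) + 2)"
      by (simp add: mult.commute)
    then have "\<bar>p\<bar> < int (M * q) + 2" by linarith
    then have "p \<in> ?P" by auto
    moreover have "t \<in> ?I p" using p assms by (auto simp: field_simps abs_less_iff)
    ultimately show "t \<in> (\<Union>p\<in>?P. ?I p)" by blast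
  qed
  then have "emeasure lborel ?T \<le> emeasure lborel (\<Union>p\<in>?P. ?I p)"
    by (intro emeasure_mono) auto
  also have "\<dots> \<le> (\<Sum>p\<in>?P. emeasure lborel (?I p))"
    by (rule emeasure_subadditive_finite) auto
  also have "\<dots> = (\<Sum>p\<in>?P. ennreal (2 * r / q))"
    using assms by (intro sum.cong refl) (auto simp: divide_right_mono field_simps)
  also have "\<dots> = ennreal ((2 * real M * q + 3) * (2 * r / q))"
    using assms by (subst sum_ennreal) (auto simp: add_ac mult_ac)
  also have "\<dots> \<le> ennreal ((2 * real M + 3) * (2 * r))"
  proof (rule ennreal_leI)
    have "(2 * real M * q + 3) * (2 * r / q) \<le> ((2 * real M + 3) * q) * (2 * r / q)"
      using assms by (intro mult_right_mono) (auto simp: algebra_simps)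
    then show "(2 * real M * q + 3) * (2 * r / q) \<le> (2 * real M + 3) * (2 * r)"
      using assms by simp
  qed
  finally show ?thesis .
qed

text \<open>Borel-Cantelli is applied on each cube of side 2 M, where measures are finite; the
  countably many exceptional null sets are then combined.\<close>

lemma null_set_of_summable:
  assumes "\<And>q. q \<ge> 1 \<Longrightarrow> \<psi> q \<ge> 0"
    and summ: "summable (\<lambda>q. if near_int (\<psi> q) (real q * x) then \<psi> q ^ DIM('a) else 0)"
  shows "{y :: 'a::euclidean_space. (x, y) \<in> approximable \<psi>} \<in> null_sets lebesgue"
proof -
  let ?Q = "\<lambda>q. q \<ge> 1 \<and> near_int (\<psi> q) (real q * x)"
  \<comment> \<open>The sets are empty unless q x is close to an integer, so only such q enter the
    sum of measures.\<close>
  define T where "T M q = (if ?Q q then {t \<in> {-real M..real M}. near_int (\<psi> q) (real q * t)} else {})" for M q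
  define C :: "nat \<Rightarrow> nat \<Rightarrow> 'a set" where "C M q = {y. \<forall>b\<in>Basis. y \<bullet> b \<in> T M q}" for M q
  have T: "T M q \<in> sets borel" for M q
  proof -
    have "{t \<in> {-real M..real M}. near_int (\<psi> q) (real q * t)} = {-real M..real M} \<inter> {t. near_int (\<psi> q) (real q * t)}"
      by auto
    then show ?thesis unfolding T_def using open_near_int by auto
  qed
  have C: "C M q \<in> sets lborel" for M q
    using sets_borel_cube[OF T] by (simp add: C_def)
  have le: "emeasure lborel (C M q) \<le>
      ennreal ((2 * (2 * real M + 3)) ^ DIM('a) * (if near_int (\<psi> q) (real q * x) then \<psi> q ^ DIM('a) else 0))" for M q
  proof (cases "?Q q")
    case True
    then have "\<psi> q \<ge> 0" using assms(1) by simp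
    have "emeasure lborel (C M q) = emeasure lborel (T M q) ^ DIM('a)"
      unfolding C_def by (rule emeasure_lborel_cube[OF T])
    also have "\<dots> \<le> ennreal ((2 * real M + 3) * (2 * \<psi> q)) ^ DIM('a)"
      using True emeasure_near_int_le[of q "\<psi> q" M] \<open>\<psi> q \<ge> 0\<close> by (intro power_mono) (auto simp: T_def)
    also have "\<dots> = ennreal (((2 * real M + 3) * (2 * \<psi> q)) ^ DIM('a))"
      using \<open>\<psi> q \<ge> 0\<close> by (intro ennreal_power) auto
    also have "((2 * real M + 3) * (2 * \<psi> q)) ^ DIM('a) = (2 * (2 * real M + 3)) ^ DIM('a) * \<psi> q ^ DIM('a)"
      by (simp only: power_mult_distrib[symmetric] mult_ac)
    finally show ?thesis using True by simp
  next
    case False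
    then have "C M q = {}" by (auto simp: C_def T_def ex_in_conv)
    then show ?thesis by simp
  qed
  have "AE y in lborel. eventually (\<lambda>q. y \<in> space lborel - C M q) sequentially" for M
  proof (rule borel_cantelli_AE1[OF C])
    show "emeasure lborel (C M q) < \<infinity>" for q
      using le[of M q] by (simp add: le_less_trans[OF _ ennreal_less_top])
    show "summable (\<lambda>q. measure lborel (C M q))"
    proof (rule summable_comparison_test_ev)
      show "summable (\<lambda>q. (2 * (2 * real M + 3)) ^ DIM('a) * (if near_int (\<psi> q) (real q * x) then \<psi> q ^ DIM('a) else 0))"
        by (intro summable_mult summ)
      show "\<forall>\<^sub>F q in sequentially. norm (measure lborel (C M q)) \<le>
        (2 * (2 * real M + 3)) ^ DIM('a) * (if near_int (\<psi> q) (real q * x) then \<psi> q ^ DIM('a) else 0)"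
        using eventually_ge_at_top[of 1]
      proof eventually_elim
        case (elim q)
        show ?case
          using le[of M q] assms(1)[OF elim] by (simp add: measure_def enn2real_leI)
      qed
    qed
  qed
  then have "AE y in lborel. \<forall>M. eventually (\<lambda>q. y \<notin> C M q) sequentially"
    by (simp add: AE_all_countable)
  then obtain N where N: "N \<in> null_sets lborel" "{y. \<not> (\<forall>M. eventually (\<lambda>q. y \<notin> C M q) sequentially)} \<subseteq> N"
    by (auto simp: eventually_ae_filter)
  have "{y. (x, y) \<in> approximable \<psi>} \<subseteq> N"
  proof (rule subset_trans[OF _ N(2)], safe)
    fix y :: 'a assume y: "(x, y) \<in> approximable \<psi>" and ev: "\<forall>M. \<forall>\<^sub>F q in sequentially. y \<notin> C M q"
    obtain M :: nat where M: "infnorm y < real M" using reals_Archimedean2 by blast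
    have "{q. q \<ge> 1 \<and> near_int (\<psi> q) (real q * x) \<and> (\<forall>b\<in>Basis. near_int (\<psi> q) (real q * (y \<bullet> b)))} \<subseteq> {q. y \<in> C M q}"
    proof safe
      fix q assume q: "q \<ge> 1" "near_int (\<psi> q) (real q * x)" "\<forall>b\<in>Basis. near_int (\<psi> q) (real q * (y \<bullet> b))"
      have "y \<bullet> b \<in> {-real M..real M}" if "b \<in> Basis" for b
        using M that unfolding infnorm_less_iff by (auto simp: abs_less_iff less_imp_le minus_le_iff)
      with q show "y \<in> C M q" by (simp add: C_def T_def)
    qed
    moreover have "finite {q. y \<in> C M q}"
      using ev[rule_format, of M] by (simp add: eventually_cofinite flip: cofinite_eq_sequentially)
    ultimately show False
      using y unfolding approximable_Pair_iff by (meson finite_subset)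
  qed
  then show ?thesis
    using N(1) by (meson null_sets_completionI null_sets_completion_subset)
qed


section \<open>Counting good denominators in windows\<close>

lemma near_int_mono: "near_int r t \<Longrightarrow> r \<le> s \<Longrightarrow> near_int s t"
  unfolding near_int_def by (meson less_le_trans)

lemma near_int_pos: "near_int r t \<Longrightarrow> r > 0"
  unfolding near_int_def by (meson abs_ge_zero le_less_trans)

text \<open>Clearing denominators turns the integer p near n x into the integer n P - p q. These
  integers are distinct within a window, as P is invertible modulo q, and they all lie close to one
  centre, as q x - P is tiny.\<close>

lemma card_near_int_window:
  fixes x r :: real and P :: int and q N :: nat
  assumes "q \<ge> 1" "r \<ge> 0" and cop: "coprime P (int q)" and close: "\<bar>real q * x - of_int P\<bar> * real q \<le> 1"
  shows "real (card {n \<in> {N..<N + q}. near_int r (real n * x)}) \<le> 2 * real q * r + 3"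
proof -
  let ?S = "{n \<in> {N..<N + q}. near_int r (real n * x)}"
  have "\<forall>n\<in>?S. \<exists>p::int. \<bar>real n * x - of_int p\<bar> < r" by (simp add: near_int_def)
  then obtain p :: "nat \<Rightarrow> int" where p: "\<And>n. n \<in> ?S \<Longrightarrow> \<bar>real n * x - of_int (p n)\<bar> < r"
    unfolding bchoice_iff by blast
  define \<epsilon> where "\<epsilon> = real q * x - of_int P"
  define h where "h n = int n * P - p n * int q" for n
  \<comment> \<open>The shift accumulated up to the start of the window; inside the window it
    changes by at most q |\<epsilon>| \<le> 1.\<close>
  define c where "c = - real N * \<epsilon>"
  have inj: "inj_on h ?S"
  proof (rule inj_onI)
    fix m n assume mn: "m \<in> ?S" "n \<in> ?S" "h m = h n"
    then have "(int m - int n) * P = (p m - p n) * int q"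
      by (simp add: h_def algebra_simps)
    then have "int q dvd (int m - int n) * P" by simp
    then have "int q dvd int m - int n"
      using cop by (simp add: coprime_commute coprime_dvd_mult_left_iff)
    moreover have "\<bar>int m - int n\<bar> < int q" using mn by auto
    ultimately have "int m - int n = 0" by (meson dvd_imp_le_int not_le abs_of_nat zdvd_not_zless dvd_abs_iff zero_less_abs_iff)
    then show "m = n" by simp
  qed
  have sub: "h ` ?S \<subseteq> {\<lceil>c - (q * r + 1)\<rceil>..\<lfloor>c + (q * r + 1)\<rfloor>}"
  proof safe
    fix n assume n: "n \<in> {N..<N + q}" "near_int r (real n * x)"
    have "real_of_int (h n) - c = real q * (real n * x - of_int (p n)) - (real n - real N) * \<epsilon>"
      by (simp add: h_def c_def \<epsilon>_def algebra_simps)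
    also have "\<bar>\<dots>\<bar> \<le> real q * \<bar>real n * x - of_int (p n)\<bar> + \<bar>real n - real N\<bar> * \<bar>\<epsilon>\<bar>"
      by (rule order_trans[OF abs_triangle_ineq4]) (simp add: abs_mult)
    also have "\<dots> \<le> real q * r + real q * \<bar>\<epsilon>\<bar>"
      using n p[of n] by (intro add_mono mult_left_mono mult_right_mono) auto
    also have "\<dots> \<le> real q * r + 1"
      using close by (simp add: \<epsilon>_def mult.commute)
    finally have "\<bar>real_of_int (h n) - c\<bar> \<le> real q * r + 1" .
    then show "h n \<in> {\<lceil>c - (q * r + 1)\<rceil>..\<lfloor>c + (q * r + 1)\<rfloor>}"
      by (simp add: ceiling_le_iff le_floor_iff abs_le_iff)
  qed
  have "card ?S = card (h ` ?S)" by (rule card_image[OF inj, symmetric])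
  also have "\<dots> \<le> card {\<lceil>c - (q * r + 1)\<rceil>..\<lfloor>c + (q * r + 1)\<rfloor>}"
    by (rule card_mono[OF _ sub]) simp
  finally have "real (card ?S) \<le> real (nat (\<lfloor>c + (q * r + 1)\<rfloor> - \<lceil>c - (q * r + 1)\<rceil> + 1))"
    by simp
  also have "\<dots> \<le> 2 * (real q * r + 1) + 1"
  proof -
    have "real_of_int (\<lfloor>b\<rfloor> - \<lceil>a\<rceil>) \<le> b - a" for a b :: real by linarith
    from this[of "c + (q * r + 1)" "c - (q * r + 1)"]
    have "\<lfloor>c + (q * r + 1)\<rfloor> - \<lceil>c - (q * r + 1)\<rceil> \<le> 2 * (real q * r + 1)" by (simp only: algebra_simps)
    moreover have "0 \<le> real q * r" using assms(2) by simp
    ultimately show ?thesis by (cases "0 \<le> \<lfloor>c + (q * r + 1)\<rfloor> - \<lceil>c - (q * r + 1)\<rceil> + 1") auto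
  qed
  finally show ?thesis by simp
qed

section \<open>Summation over the windows between consecutive continuants\<close>

context
  fixes x :: real and \<psi> :: "nat \<Rightarrow> real" and e :: nat
  assumes irr: "x \<notin> \<rat>"
    and nonneg: "\<And>q. q \<ge> 1 \<Longrightarrow> \<psi> q \<ge> 0"
    and anti: "antimono_on {1..} \<psi>"
    and e: "e \<ge> 1"
begin

private definition near_term :: "nat \<Rightarrow> real" where
  "near_term q = (if near_int (\<psi> q) (real q * x) then \<psi> q ^ e else 0)"

private definition psum :: "nat \<Rightarrow> real" where
  "psum N = (\<Sum>n<N. \<psi> (Suc n) ^ Suc e)"

private definition den :: "nat \<Rightarrow> nat" where
  "den n = nat (continuant_aux x n)"

private lemma psi_mono: "1 \<le> m \<Longrightarrow> m \<le> n \<Longrightarrow> \<psi> n \<le> \<psi> m"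
  using anti by (auto simp: monotone_on_def)

private lemma near_term_nonneg: "near_term q \<ge> 0"
  using near_int_pos[of "\<psi> q"] by (auto simp: near_term_def less_imp_le)

private lemma of_int_continuant_aux: "real_of_int (continuant_aux x n) = real (den n)"
  unfolding den_def using continuant_aux_nonneg[OF irr, of n] by simp

private lemma den_Suc_pos: "den (Suc n) \<ge> 1"
  unfolding den_def using continuant_aux_Suc_ge_1[OF irr, of n] by simp

private lemma near_term_window:
  assumes q: "q = den (Suc k)" and N: "N \<ge> 1"
  shows "sum near_term {N..<N + q} \<le> 5 * (real q * \<psi> N ^ Suc e) + 3 / real q"
proof -
  let ?\<delta> = "\<psi> N"
  have \<delta>: "?\<delta> \<ge> 0" using nonneg N by simp
  have q1: "q \<ge> 1" unfolding q by (rule den_Suc_pos)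
  let ?S = "{n \<in> {N..<N + q}. near_int ?\<delta> (real n * x)}"
  have "sum near_term {N..<N + q} \<le> (\<Sum>n\<in>{N..<N + q}. if near_int ?\<delta> (real n * x) then ?\<delta> ^ e else 0)"
    using N nonneg psi_mono near_int_mono
    by (intro sum_mono) (auto simp: near_term_def intro!: power_mono)
  also have "\<dots> = ?\<delta> ^ e * real (card ?S)"
    by (subst sum.inter_filter[symmetric]) simp_all
  also have "\<dots> \<le> ?\<delta> ^ e * (2 * real q * ?\<delta> + 3)"
  proof (intro mult_left_mono card_near_int_window q1 \<delta>)
    show "coprime (conv_num x (Suc k)) (int q)"
      using coprime_conv[of x "Suc k"] continuant_aux_nonneg[OF irr, of "Suc k"] by (simp add: q den_def)
    have "\<bar>conv_err x (Suc k)\<bar> * real q \<le> \<bar>conv_err x (Suc k)\<bar> * of_int (continuant_aux x (Suc (Suc k)))"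
      unfolding q of_int_continuant_aux[symmetric]
      using monoD[OF mono_continuant_aux[OF irr], of "Suc k" "Suc (Suc k)"]
      by (intro mult_left_mono) (auto simp del: continuant_aux.simps)
    also have "\<dots> \<le> 1" by (rule conv_err_bound[OF irr])
    finally show "\<bar>real q * x - of_int (conv_num x (Suc k))\<bar> * real q \<le> 1"
      by (simp add: conv_err_def q of_int_continuant_aux)
  qed (use \<delta> in auto)
  also have "\<dots> = 2 * (real q * ?\<delta> ^ Suc e) + 3 * ?\<delta> ^ e" by (simp add: algebra_simps)
  \<comment> \<open>The additive 3 of the window count lacks a factor q \<delta>. If q \<delta>
    \<ge> 1, the main term absorbs it; otherwise \<delta> < 1 / q, and e \<ge> 1 leaves an error of
    at most 1 / q.\<close>
  also have "?\<delta> ^ e \<le> real q * ?\<delta> ^ Suc e + 1 / real q"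
  proof (cases "real q * ?\<delta> \<ge> 1")
    case True
    then have "1 * ?\<delta> ^ e \<le> (real q * ?\<delta>) * ?\<delta> ^ e"
      using \<delta> by (intro mult_right_mono) auto
    then have "?\<delta> ^ e \<le> real q * ?\<delta> ^ Suc e" by (simp add: mult_ac)
    then show ?thesis by (rule order_trans) simp
  next
    case False
    then have "?\<delta> \<le> 1 / real q" using q1 by (simp add: field_simps)
    then have "?\<delta> ^ e \<le> (1 / real q) ^ e" using \<delta> by (intro power_mono) auto
    also have "\<dots> \<le> (1 / real q) ^ 1" using q1 e by (intro power_decreasing) auto
    moreover have "0 \<le> real q * ?\<delta> ^ Suc e" using \<delta> by simp
    ultimately show ?thesis by simp
  qed
  finally show ?thesis by (simp add: algebra_simps)
qed

text \<open>Serves to charge the main term of a window to the part of the convergent series just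
  before it.\<close>

private lemma psum_diff_ge:
  assumes "M \<le> N" "N \<ge> 1"
  shows "(real N - real M) * \<psi> N ^ Suc e \<le> psum N - psum M"
proof -
  have "psum N - psum M = (\<Sum>n=M..<N. \<psi> (Suc n) ^ Suc e)"
    unfolding psum_def by (metis assms(1) lessThan_atLeast0 sum_diff_nat_ivl zero_le)
  also have "\<dots> \<ge> (\<Sum>n=M..<N. \<psi> N ^ Suc e)"
    using assms nonneg psi_mono by (intro sum_mono power_mono) auto
  finally show ?thesis using assms by (simp add: of_nat_diff)
qed

private lemma psum_mono: "mono psum"
  unfolding psum_def by (rule incseq_SucI) (simp add: nonneg)

text \<open>The windows start at q, 2 q, ..., a q. The one at j q with j \<ge> 2 is charged to the
  series between (j - 1) q and j q; the first keeps its own term, to be charged later to smaller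
  denominators.\<close>

private lemma near_term_windows:
  assumes q: "q = den (Suc k)"
  shows "sum near_term {q..<Suc a * q} \<le>
    5 * (if a = 0 then 0 else real q * \<psi> q ^ Suc e + psum (a * q) - psum q) + 3 * real a / real q"
proof (induction a)
  case (Suc a)
  have q1: "q \<ge> 1" unfolding q by (rule den_Suc_pos)
  have eq: "sum near_term {q..<Suc (Suc a) * q} = sum near_term {q..<Suc a * q} + sum near_term {Suc a * q..<Suc a * q + q}"
    by (subst sum.atLeastLessThan_concat) (auto simp: algebra_simps)
  have w: "sum near_term {Suc a * q..<Suc a * q + q} \<le> 5 * (real q * \<psi> (Suc a * q) ^ Suc e) + 3 / real q"
    using q1 by (intro near_term_window[OF q]) auto
  have "real q * \<psi> (Suc a * q) ^ Suc e \<le> psum (Suc a * q) - psum (a * q)" 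
    using psum_diff_ge[of "a * q" "Suc a * q"] q1 by (simp add: algebra_simps)
  with Suc eq w show ?case
    by (cases "a = 0") (simp_all add: algebra_simps add_divide_distrib del: power_Suc)
qed simp

private lemma near_term_windows':
  assumes "q = den (Suc k)" "a \<ge> 1"
  shows "sum near_term {q..<Suc a * q} \<le>
    5 * (real q * \<psi> q ^ Suc e + psum (a * q) - psum q) + 3 * real a / real q"
  using near_term_windows[OF assms(1), of a] assms(2) by (cases "a = 0") simp_all

text \<open>The main terms telescope against the convergent series of
  \<open>\<psi> q ^ Suc e\<close>. The windows of length q_k number about q_{k+1} / q_k, each with
  an error of order 1 / q_k, and \<open>growth\<close> sums these errors.\<close>

lemma summable_near_term:
  assumes "summable (\<lambda>q. \<psi> q ^ Suc e)"
    and growth: "summable (\<lambda>n. real_of_int (continuant_aux x (Suc n)) / real_of_int (continuant_aux x n) ^ 2)"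
  shows "summable (\<lambda>q. if near_int (\<psi> q) (real q * x) then \<psi> q ^ e else 0)"
proof -
  define G where "G n = psum (den n)" for n
  \<comment> \<open>First window, later windows and errors for one stretch between consecutive
    continuants. The offset 2 leaves room to look two continuants back.\<close>
  define T where "T n = 5 * (2 * (G (n + 2) - G n) + (G (n + 3) - G (n + 2))) + 3 * (real (den (n + 3)) / real (den (n + 2)) ^ 2)" for n
  have summ: "summable (\<lambda>n. \<psi> (Suc n) ^ Suc e)"
    using summable_ignore_initial_segment[OF assms(1), of 1] by simp
  have "mono den"
    using monoD[OF mono_continuant_aux[OF irr]] by (auto simp: den_def intro!: monoI nat_mono)
  have "incseq G"
    unfolding G_def using psum_mono \<open>mono den\<close> by (auto simp: mono_def)
  moreover have "G n \<le> (\<Sum>n. \<psi> (Suc n) ^ Suc e)" for n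
    unfolding G_def psum_def using nonneg by (intro sum_le_suminf[OF summ]) auto
  ultimately obtain L where "G \<longlonglongrightarrow> L" by (metis incseq_convergent)
  then have dG: "summable (\<lambda>n. G (Suc n) - G n)" by (rule telescope_summable)
  have T_eq: "T n = 10 * (G (Suc (n + 1)) - G (n + 1)) + 10 * (G (Suc n) - G n) + 5 * (G (Suc (n + 2)) - G (n + 2))
      + 3 * (real (den (n + 3)) / real (den (n + 2)) ^ 2)" for n
    by (simp add: T_def eval_nat_numeral)
  have "summable T"
  proof -
    have "summable (\<lambda>n. real (den (n + 3)) / real (den (n + 2)) ^ 2)"
      using summable_ignore_initial_segment[OF growth, of 2]
      by (simp add: of_int_continuant_aux eval_nat_numeral del: continuant_aux.simps)
    with dG summable_ignore_initial_segment[OF dG, of 1] summable_ignore_initial_segment[OF dG, of 2]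
    show ?thesis unfolding T_eq by (intro summable_add summable_mult) auto
  qed
  have le_T: "sum near_term {den (n + 2)..<den (n + 3)} \<le> T n" for n
  proof -
    let ?q = "den (n + 2)" and ?a = "nat (partial_quotient x (n + 2))"
    have q1: "?q \<ge> 1" using den_Suc_pos[of "n + 1"] by simp
    have a1: "?a \<ge> 1" using partial_quotient_Suc_ge_1[OF irr, of "n + 1"] by simp
    \<comment> \<open>The remainder \<open>den (n + 1)\<close> is at most \<open>?q\<close>, so
      \<open>?a\<close> windows of length \<open>?q\<close> starting at \<open>?q\<close> cover the
      stretch.\<close>
    have rec: "den (n + 3) = ?a * ?q + den (n + 1)"
      using continuant_aux_nonneg[OF irr, of "n + 1"] continuant_aux_nonneg[OF irr, of "n + 2"] a1
      by (simp add: den_def eval_nat_numeral nat_add_distrib nat_mult_distrib del: continuant_aux.simps)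
        (simp add: nat_add_distrib nat_mult_distrib)
    have "den (n + 1) \<le> ?q" by (rule monoD[OF \<open>mono den\<close>]) simp
    then have "sum near_term {?q..<den (n + 3)} \<le> sum near_term {?q..<Suc ?a * ?q}"
      using near_term_nonneg by (intro sum_mono2) (auto simp: rec)
    also have "\<dots> \<le> 5 * (real ?q * \<psi> ?q ^ Suc e + psum (?a * ?q) - psum ?q) + 3 * real ?a / real ?q"
      by (rule near_term_windows'[of _ "n + 1"]) (use a1 in simp_all)
    \<comment> \<open>The first window is charged to the stretch from \<open>den n\<close> to
      \<open>?q\<close>, which makes up at least half of \<open>?q\<close> by two-step doubling.
      Such stretches overlap only boundedly often.\<close>
    also have "real ?q * \<psi> ?q ^ Suc e \<le> 2 * (G (n + 2) - G n)"
    proof -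
      have "2 * den n \<le> ?q"
        using continuant_aux_double[OF irr, of n] unfolding den_def by simp
      then have "real ?q * \<psi> ?q ^ Suc e \<le> 2 * ((real ?q - real (den n)) * \<psi> ?q ^ Suc e)"
        using nonneg[OF q1] by (simp only: mult.assoc[symmetric]) (intro mult_right_mono, auto)
      also have "\<dots> \<le> 2 * (G (n + 2) - G n)"
        using psum_diff_ge[of "den n" ?q] q1 \<open>2 * den n \<le> ?q\<close> by (simp add: G_def)
      finally show ?thesis .
    qed
    also have "psum (?a * ?q) \<le> G (n + 3)"
      unfolding G_def rec by (rule monoD[OF psum_mono]) simp
    also have "3 * real ?a / real ?q \<le> 3 * (real (den (n + 3)) / real ?q ^ 2)"
      using q1 by (simp add: rec field_simps power2_eq_square)
    finally show ?thesis by (simp add: T_def G_def)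
  qed
  have T_nonneg: "T n \<ge> 0" for n
    using le_T[of n] sum_nonneg[of "{den (n + 2)..<den (n + 3)}" near_term] near_term_nonneg by force
  have partial: "sum near_term {..<den (m + 2)} \<le> sum near_term {..<den 2} + sum T {..<m}" for m
  proof (induction m)
    case (Suc m)
    have "sum near_term {..<den (Suc m + 2)} = sum near_term {..<den (m + 2)} + sum near_term {den (m + 2)..<den (m + 3)}"
      using monoD[OF \<open>mono den\<close>, of "m + 2" "m + 3"]
      by (simp add: lessThan_atLeast0 sum.atLeastLessThan_concat eval_nat_numeral)
    with Suc le_T[of m] show ?case by simp
  qed (simp add: numeral_2_eq_2)
  have ge: "n \<le> den (n + 2)" for n
    using continuant_aux_Suc_ge[OF irr, of "n + 1"] unfolding den_def by simp
  have "summable near_term"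
  proof (rule summableI_nonneg_bounded[OF near_term_nonneg])
    fix n
    have "sum near_term {..<n} \<le> sum near_term {..<den (n + 2)}"
      using near_term_nonneg ge[of n] by (intro sum_mono2) auto
    also have "\<dots> \<le> sum near_term {..<den 2} + sum T {..<n}" by (rule partial)
    also have "sum T {..<n} \<le> suminf T"
      using T_nonneg by (intro sum_le_suminf \<open>summable T\<close>) auto
    finally show "sum near_term {..<n} \<le> sum near_term {..<den 2} + suminf T" by simp
  qed
  then show ?thesis unfolding near_term_def .
qed

end


section \<open>Blocks\<close>

declare continuant_aux.simps(3) [simp del]

text \<open>\<open>shifted_index x R m\<close> is \<open>k\<^sub>m + 1\<close>, so that \<^const>\<open>continuant_aux\<close> at this index is the
  continuant of index \<open>k\<^sub>m\<close>.\<close>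

definition shifted_index :: "real \<Rightarrow> nat \<Rightarrow> nat \<Rightarrow> nat" where
  "shifted_index x R m = (case m of 0 \<Rightarrow> 0 | Suc m \<Rightarrow> Suc (enumerate (large_indices x R) m))"

lemma continuant_large_index:
  "continuant x (large_index x R m) = continuant_aux x (shifted_index x R m)"
  "continuant x (large_index x R m + 1) = continuant_aux x (Suc (shifted_index x R m))"
  by (auto simp: continuant_def large_index_def shifted_index_def nat_add_distrib split: nat.split)

lemma strict_mono_shifted_index:
  assumes "infinite (large_indices x R)"
  shows "strict_mono (shifted_index x R)"
proof (rule strict_monoI_Suc)
  show "shifted_index x R m < shifted_index x R (Suc m)" for m
    using enumerate_step[OF assms] by (auto simp: shifted_index_def split: nat.split)
qed

text \<open>At index m this is the left end of the block B_{m+1}, while \<open>block_end\<close> is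
  the right end of B_m. Both are expressed by k_m, and for m \<ge> 1 their difference is the
  gap.\<close>

definition block_start :: "real \<Rightarrow> nat \<Rightarrow> nat \<Rightarrow> int" where
  "block_start x R m = continuant_aux x (Suc (shifted_index x R m)) - int R * continuant_aux x (shifted_index x R m)"

definition block_end :: "real \<Rightarrow> nat \<Rightarrow> nat \<Rightarrow> int" where
  "block_end x R m = continuant_aux x (shifted_index x R m)"

context
  fixes x :: real and R :: nat
  assumes irr: "x \<notin> \<rat>" and inf: "infinite (large_indices x R)"
begin

text \<open>For m \<ge> 1 the partial quotient following k_m is at least R + 1; this makes the gaps
  nonnegative.\<close>

lemma block_end_le_block_start: "block_end x R m \<le> block_start x R m"
proof (cases m)
  case (Suc j)
  let ?k = "enumerate (large_indices x R) j" and ?Q = "continuant_aux x"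
  have "?k \<in> large_indices x R" by (rule enumerate_in_set[OF inf])
  then have "(int R + 1) * ?Q (Suc ?k) \<le> partial_quotient x (Suc ?k) * ?Q (Suc ?k)"
    using continuant_aux_nonneg[OF irr, of "Suc ?k"] by (intro mult_right_mono) (auto simp: large_indices_def)
  with continuant_aux_nonneg[OF irr, of ?k] show ?thesis
    by (simp add: Suc block_start_def block_end_def shifted_index_def continuant_aux.simps(3) algebra_simps)
qed (simp add: block_start_def block_end_def shifted_index_def)

lemma block_end_pos: "block_end x R (Suc m) \<ge> 1"
  using continuant_aux_Suc_ge_1[OF irr] by (simp add: block_end_def shifted_index_def)

lemma block_start_pos: "block_start x R m \<ge> 1"
proof (cases m)
  case (Suc j)
  then show ?thesis using block_end_le_block_start[of m] block_end_pos[of j] by simp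
qed (simp add: block_start_def shifted_index_def)

lemma block_start_le: "block_start x R m \<le> continuant_aux x (Suc (shifted_index x R m))"
  using continuant_aux_nonneg[OF irr] by (simp add: block_start_def)

lemma block_start_le_block_end: "block_start x R m \<le> block_end x R (Suc m)"
proof -
  have "Suc (shifted_index x R m) \<le> shifted_index x R (Suc m)"
    using strict_monoD[OF strict_mono_shifted_index[OF inf], of m "Suc m"] by simp
  then show ?thesis
    using block_start_le[of m] monoD[OF mono_continuant_aux[OF irr]]
    unfolding block_end_def by (meson order_trans)
qed

lemma block_eq: "block x R (Suc m) = {nat (block_start x R m)..nat (block_end x R (Suc m))}"
proof -
  have "block x R (Suc m) = {n. n \<ge> 1 \<and> block_start x R m \<le> int n \<and> int n \<le> block_end x R (Suc m)}"
    using inf by (simp add: block_def continuant_large_index block_start_def block_end_def)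
  moreover have "{n. n \<ge> 1 \<and> A \<le> int n \<and> int n \<le> B} = {nat A..nat B}" if "A \<ge> 1" "B \<ge> 1" for A B
  proof (rule set_eqI)
    fix n show "n \<in> {n. n \<ge> 1 \<and> A \<le> int n \<and> int n \<le> B} \<longleftrightarrow> n \<in> {nat A..nat B}"
      using that unfolding mem_Collect_eq atLeastAtMost_iff by linarith
  qed
  ultimately show ?thesis
    using block_start_pos[of m] block_end_pos[of m] by simp
qed

lemma block_gap_eq: "block_gap x R (Suc m) = block_start x R (Suc m) - block_end x R (Suc m)"
proof -
  have "nat (block_start x R m) \<le> nat (block_end x R (Suc m))" for m
    using block_start_le_block_end by (rule nat_mono)
  then have "Inf (block x R (Suc (Suc m))) = nat (block_start x R (Suc m))"
      "Max (block x R (Suc m)) = nat (block_end x R (Suc m))"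
    unfolding block_eq by (simp_all add: cInf_atLeastAtMost Max_eq_iff)
  then show ?thesis
    using block_start_pos[of "Suc m"] block_end_pos[of m]
    by (simp add: block_gap_def)
qed

lemma sum_block_le_block_sum: "(\<Sum>n\<in>block x R (Suc m). n) \<le> block_sum x R (Suc m)"
  unfolding block_sum_def by (rule member_le_sum[where f = "\<lambda>i. \<Sum>n\<in>block x R i. n"]) simp_all

text \<open>A block ending at q has sum at most q^2, and the squares of continuants grow at least
  fourfold in two steps, so the last block dominates.\<close>

lemma block_sum_le: "real (block_sum x R (Suc m)) \<le> 3 * real_of_int (block_end x R (Suc m)) ^ 2"
proof -
  let ?Q = "\<lambda>n. real_of_int (continuant_aux x n)" and ?\<kappa> = "shifted_index x R"
  have mono: "?Q k \<le> ?Q n" if "k \<le> n" for k n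
    using monoD[OF mono_continuant_aux[OF irr] that] by simp
  have Q0: "?Q n \<ge> 0" for n using continuant_aux_nonneg[OF irr] by simp
  have block: "real (\<Sum>n\<in>block x R i. n) \<le> ?Q (?\<kappa> i) ^ 2" if "i \<in> {1..Suc m}" for i
  proof -
    from that have "i \<ge> 1" by simp
    then obtain j where i: "i = Suc j" by (cases i) simp_all
    define a b where "a = nat (block_start x R j)" and "b = nat (block_end x R i)"
    have "a \<ge> 1" using block_start_pos[of j] by (simp add: a_def)
    have block: "block x R i = {a..b}" by (simp add: i block_eq a_def b_def)
    have "(\<Sum>n\<in>{a..b}. n) \<le> (\<Sum>n\<in>{a..b}. b)" by (rule sum_mono) simp
    also have "\<dots> = card {a..b} * b" by simp
    also have "\<dots> \<le> b * b" using \<open>a \<ge> 1\<close> by (intro mult_right_mono) simp_all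
    finally have "real (\<Sum>n\<in>block x R i. n) \<le> real (b * b)" unfolding block by (rule of_nat_mono)
    also have "\<dots> = ?Q (?\<kappa> i) ^ 2"
      using continuant_aux_nonneg[OF irr] by (simp add: b_def block_end_def power2_eq_square)
    finally show ?thesis .
  qed
  \<comment> \<open>The constant 3 closes the two-step induction, as 3 / 4 + 1 + 1 \<le> 3.\<close>
  have squares: "(\<Sum>j\<le>n. ?Q j ^ 2) \<le> 3 * ?Q n ^ 2" for n
  proof (induction n rule: nat_induct2)
    case (step n)
    have "(2 * ?Q n) ^ 2 \<le> ?Q (n + 2) ^ 2"
    proof (rule power_mono)
      show "2 * ?Q n \<le> ?Q (n + 2)"
        using continuant_aux_double[OF irr, of n] unfolding add_2_eq_Suc' by linarith
    qed (use Q0[of n] in simp)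
    moreover have "?Q (n + 1) ^ 2 \<le> ?Q (n + 2) ^ 2"
      using Q0 by (intro power_mono mono) auto
    moreover have "(\<Sum>j\<le>n + 2. ?Q j ^ 2) = (\<Sum>j\<le>n. ?Q j ^ 2) + ?Q (n + 1) ^ 2 + ?Q (n + 2) ^ 2"
      by simp
    moreover have "(2 * ?Q n) ^ 2 = 4 * ?Q n ^ 2" by (simp add: power_mult_distrib)
    moreover have "0 \<le> ?Q n ^ 2" by simp
    ultimately show ?case using step by linarith
  qed simp_all
  have inj: "inj_on ?\<kappa> A" for A
    by (rule strict_mono_imp_inj_on[OF strict_mono_shifted_index[OF inf]])
  have "real (block_sum x R (Suc m)) = (\<Sum>i\<in>{1..Suc m}. real (\<Sum>n\<in>block x R i. n))"
    by (simp add: block_sum_def)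
  also have "\<dots> \<le> (\<Sum>i\<in>{1..Suc m}. ?Q (?\<kappa> i) ^ 2)" by (rule sum_mono[OF block])
  also have "\<dots> = (\<Sum>j\<in>?\<kappa> ` {1..Suc m}. ?Q j ^ 2)" by (simp add: sum.reindex[OF inj])
  also have "\<dots> \<le> (\<Sum>j\<le>?\<kappa> (Suc m). ?Q j ^ 2)"
  proof (rule sum_mono2)
    show "?\<kappa> ` {1..Suc m} \<subseteq> {..?\<kappa> (Suc m)}"
      using strict_mono_less_eq[OF strict_mono_shifted_index[OF inf]] by (simp add: image_subset_iff)
  qed simp_all
  also have "\<dots> \<le> 3 * ?Q (?\<kappa> (Suc m)) ^ 2" by (rule squares)
  finally show ?thesis by (simp add: block_end_def)
qed

lemma block_sum_pos: "block_sum x R (Suc m) > 0"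
proof -
  have "nat (block_end x R (Suc m)) \<in> block x R (Suc m)"
    unfolding block_eq using nat_mono[OF block_start_le_block_end] by simp
  then have "nat (block_end x R (Suc m)) \<le> (\<Sum>n\<in>block x R (Suc m). n)"
    by (rule member_le_sum) (simp_all add: block_eq)
  then show ?thesis using block_end_pos[of m] sum_block_le_block_sum[of m] by simp
qed

end

text \<open>Unless a partial quotient is large, q_{k+1} is at most (R + 1) q_k; if it is large, the
  excess over (R + 1) q_k is a gap. The first part sums by exponential growth, the second because
  block sums are at most 3 q_k^2.\<close>

lemma bounded_ratio_imp_summable_growth:
  assumes irr: "x \<notin> \<rat>" and "bounded_ratio x"
  shows "summable (\<lambda>n. real_of_int (continuant_aux x (Suc n)) / real_of_int (continuant_aux x n) ^ 2)"
proof -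
  let ?Q = "\<lambda>n. real_of_int (continuant_aux x n)"
  obtain R where br: "infinite (large_indices x R) \<Longrightarrow>
      summable (\<lambda>m. real_of_int (block_gap x R (Suc m)) / real (block_sum x R (Suc m)))"
    using assms(2) by (auto simp: bounded_ratio_def)
  define L where "L = large_indices x R"
  define e where "e k = (if k \<in> L then (?Q (Suc (Suc k)) - (R + 1) * ?Q (Suc k)) / ?Q (Suc k) ^ 2 else 0)" for k
  have pos: "?Q (Suc k) > 0" for k
    using continuant_aux_Suc_ge_1[OF irr, of k] by simp
  have "summable e"
  proof (cases "finite L")
    case True
    then show ?thesis by (rule summable_finite) (simp add: e_def)
  next
    case False
    then have inf: "infinite (large_indices x R)" by (simp add: L_def)
    have "summable (\<lambda>m. e (enumerate L m))"
    proof (rule summable_comparison_test')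
      show "summable (\<lambda>m. 3 * (real_of_int (block_gap x R (Suc m)) / real (block_sum x R (Suc m))))"
        by (intro summable_mult br inf)
      fix m :: nat
      have eq: "e (enumerate L m) = real_of_int (block_gap x R (Suc m)) / real_of_int (block_end x R (Suc m)) ^ 2"
        using enumerate_in_set[OF False, of m]
        by (simp add: e_def block_gap_eq[OF irr inf] block_start_def block_end_def shifted_index_def L_def ring_distribs
         )
      have gap: "block_gap x R (Suc m) \<ge> 0"
        using block_end_le_block_start[OF irr inf, of "Suc m"] by (simp add: block_gap_eq[OF irr inf])
      have "real_of_int (block_gap x R (Suc m)) / real_of_int (block_end x R (Suc m)) ^ 2
        = 3 * real_of_int (block_gap x R (Suc m)) / (3 * real_of_int (block_end x R (Suc m)) ^ 2)" by simp
      also have "\<dots> \<le> 3 * real_of_int (block_gap x R (Suc m)) / real (block_sum x R (Suc m))"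
        using gap block_sum_pos[OF irr inf, of m] block_sum_le[OF irr inf, of m] block_end_pos[OF irr inf, of m]
        by (intro divide_left_mono) auto
      finally show "norm (e (enumerate L m)) \<le> 3 * (real_of_int (block_gap x R (Suc m)) / real (block_sum x R (Suc m)))"
        unfolding eq using gap by simp
    qed
    \<comment> \<open>\<open>e\<close> vanishes off \<open>L\<close>, so summation along the
      enumeration of \<open>L\<close> captures all of it.\<close>
    moreover have "summable (\<lambda>m. e (enumerate L m)) \<longleftrightarrow> summable e"
      using False by (intro summable_mono_reindex) (simp_all add: strict_mono_enumerate range_enumerate e_def)
    ultimately show ?thesis by simp
  qed
  have inv: "summable (\<lambda>k. 1 / ?Q (Suc k))"
    using summable_continuant_aux_powr[OF irr, of 1] pos
    by (simp add: powr_minus_divide less_imp_le)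
  have "summable (\<lambda>k. ?Q (Suc (Suc k)) / ?Q (Suc k) ^ 2)"
  proof (rule summable_comparison_test')
    show "summable (\<lambda>k. (R + 1) * (1 / ?Q (Suc k)) + e k)"
      by (intro summable_add summable_mult inv \<open>summable e\<close>)
    fix k :: nat
    have "?Q (Suc (Suc k)) / ?Q (Suc k) ^ 2 \<le> (R + 1) * (1 / ?Q (Suc k)) + e k"
    proof (cases "k \<in> L")
      case True
      then show ?thesis using pos[of k] by (simp add: e_def field_simps power2_eq_square)
    next
      case False
      then have "partial_quotient x (Suc k) \<le> int R" by (simp add: L_def large_indices_def)
      then have "real_of_int (partial_quotient x (Suc k)) * ?Q (Suc k) \<le> R * ?Q (Suc k)"
        using pos[of k] by (intro mult_right_mono) auto
      moreover have "?Q k \<le> ?Q (Suc k)"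
        using monoD[OF mono_continuant_aux[OF irr], of k "Suc k"] by simp
      ultimately have "?Q (Suc (Suc k)) \<le> (R + 1) * ?Q (Suc k)" by (simp add: continuant_aux.simps(3) algebra_simps)
      then have "?Q (Suc (Suc k)) / ?Q (Suc k) ^ 2 \<le> (R + 1) * ?Q (Suc k) / ?Q (Suc k) ^ 2"
        by (intro divide_right_mono) auto
      then show ?thesis using False pos[of k] by (simp add: e_def power2_eq_square)
    qed
    then show "norm (?Q (Suc (Suc k)) / ?Q (Suc k) ^ 2) \<le> (R + 1) * (1 / ?Q (Suc k)) + e k"
      using pos[of k] pos[of "Suc k"] by simp
  qed
  then show ?thesis by (subst summable_Suc_iff[symmetric])
qed


section \<open>Diophantine type\<close>

lemma approximable_real_iff:
  fixes x :: real
  shows "x \<in> approximable \<psi> \<longleftrightarrow> infinite {q. q \<ge> 1 \<and> near_int (\<psi> q) (real q * x)}"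
  unfolding approximable_iff by simp

text \<open>At the multiples of its denominator a rational number has error 0, so every exponent is
  admissible.\<close>

lemma diophantine_type_less_imp_irrational:
  assumes "diophantine_type x < ereal c"
  shows "x \<notin> \<rat>"
proof
  assume "x \<in> \<rat>"
  then obtain a b where ab: "b > 0" "x = of_int a / of_int b"
    by (metis Rats_cases')
  \<comment> \<open>Any positive exponent that is at least c yields the contradiction.\<close>
  define t where "t = max c 1"
  let ?S = "{q. q \<ge> 1 \<and> near_int (real q powr (- t)) (real q * x)}"
  have "range (\<lambda>n. nat b * Suc n) \<subseteq> ?S"
  proof safe
    fix n
    define N where "N = nat b * Suc n"
    have N: "N \<ge> 1" using ab by (simp add: N_def)
    have "real N = of_int b * real (Suc n)" using ab by (simp add: N_def distrib_left)
    then have eq: "real N * x = of_int (a * int (Suc n))"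
      using ab by (simp add: field_simps distrib_left)
    have "real N powr (- t) > 0" using N by simp
    then have "near_int (real N powr (- t)) (real N * x)"
      unfolding near_int_def eq by (intro exI[of _ "a * int (Suc n)"]) simp
    with N show "1 \<le> nat b * Suc n" "near_int (real (nat b * Suc n) powr (- t)) (real (nat b * Suc n) * x)"
      unfolding N_def .
  qed
  moreover have "infinite (range (\<lambda>n. nat b * Suc n))"
    using ab by (intro range_inj_infinite injI) simp
  ultimately have "infinite ?S" using finite_subset by blast
  then have "x \<in> approximable (\<lambda>q. real q powr (- t))" by (simp add: approximable_real_iff)
  then have "ereal t \<le> diophantine_type x"
    unfolding diophantine_type_def by (intro Sup_upper CollectI exI[of _ t]) (simp add: t_def)
  then have "ereal t < ereal c" using assms by (rule le_less_trans)
  then show False by (simp add: t_def)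
qed

text \<open>For \<tau> strictly above the type, only finitely many q have an error below
  q^(-\<tau>). The convergent with denominator q_n has error at most 1 / q_{n+1}, so q_{n+1} \<le>
  q_n^\<tau> for large n.\<close>

lemma diophantine_type_less_imp_growth:
  assumes "diophantine_type x < ereal c" "c > 1"
  obtains \<tau> where "1 < \<tau>" "\<tau> < c"
    "\<forall>\<^sub>F n in sequentially. real_of_int (continuant_aux x (Suc n)) \<le> real_of_int (continuant_aux x n) powr \<tau>"
proof -
  have irr: "x \<notin> \<rat>" by (rule diophantine_type_less_imp_irrational[OF assms(1)])
  have "max (diophantine_type x) 1 < ereal c" using assms by simp
  then obtain \<tau> where "max (diophantine_type x) 1 < ereal \<tau>" "ereal \<tau> < ereal c"
    using ereal_dense2 by blast
  then have \<tau>: "diophantine_type x < ereal \<tau>" "1 < \<tau>" "\<tau> < c" by auto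
  have "x \<notin> approximable (\<lambda>q. real q powr (- \<tau>))"
  proof
    assume "x \<in> approximable (\<lambda>q. real q powr (- \<tau>))"
    then have "ereal \<tau> \<le> diophantine_type x"
      unfolding diophantine_type_def using \<tau> by (intro Sup_upper) auto
    with \<tau>(1) show False by simp
  qed
  then obtain B where B: "\<And>q. q \<ge> 1 \<Longrightarrow> near_int (real q powr (- \<tau>)) (real q * x) \<Longrightarrow> q \<le> B"
    by (auto simp: approximable_real_iff finite_nat_set_iff_bounded_le)
  have "real_of_int (continuant_aux x (Suc n)) \<le> real_of_int (continuant_aux x n) powr \<tau>" if "n \<ge> B + 2" for n
  proof -
    define k where "k = n - 1"
    have k: "n = Suc k" "k > B" using that by (simp_all add: k_def)
    let ?q = "nat (continuant_aux x n)"
    have "int k \<le> continuant_aux x n" using continuant_aux_Suc_ge[OF irr, of k] k by simp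
    then have q: "?q > B" "real ?q = of_int (continuant_aux x n)" using k by auto
    have "\<not> near_int (real ?q powr (- \<tau>)) (real ?q * x)" using B[of ?q] q(1) by auto
    then have "real ?q powr (- \<tau>) \<le> \<bar>conv_err x n\<bar>"
      unfolding near_int_def conv_err_def q(2) by (meson not_le)
    then have "real ?q powr (- \<tau>) * of_int (continuant_aux x (Suc n)) \<le> \<bar>conv_err x n\<bar> * of_int (continuant_aux x (Suc n))"
      using continuant_aux_nonneg[OF irr, of "Suc n"] by (intro mult_right_mono) auto
    also have "\<dots> \<le> 1" unfolding k by (rule conv_err_bound[OF irr])
    finally have "of_int (continuant_aux x (Suc n)) / real ?q powr \<tau> \<le> 1"
      by (simp add: powr_minus divide_inverse mult.commute)
    moreover have "real ?q powr \<tau> > 0" using q(1) by simp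
    ultimately have "of_int (continuant_aux x (Suc n)) \<le> 1 * real ?q powr \<tau>"
      by (simp only: pos_divide_le_eq)
    then show ?thesis unfolding q(2) by simp
  qed
  then show thesis
    by (intro that[OF \<tau>(2,3)] eventually_sequentiallyI)
qed

section \<open>Sufficient conditions for bounded ratio\<close>

lemma block_sum_ge:
  assumes irr: "x \<notin> \<rat>" and inf: "infinite (large_indices x R)"
    and a: "block_start x R m \<le> a" "a \<le> block_end x R (Suc m)"
  shows "(block_end x R (Suc m) - a + 1) * a \<le> int (block_sum x R (Suc m))"
proof -
  let ?b = "block_end x R (Suc m)"
  have a1: "a \<ge> 1" using a(1) block_start_pos[OF irr inf, of m] by simp
  have "nat ?b + 1 - nat a = nat (?b - a + 1)" using a a1 by linarith
  then have "nat (?b - a + 1) * nat a = (\<Sum>n\<in>{nat a..nat ?b}. nat a)"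
    by simp
  also have "\<dots> \<le> (\<Sum>n\<in>{nat a..nat ?b}. n)" by (rule sum_mono) simp
  also have "\<dots> \<le> (\<Sum>n\<in>block x R (Suc m). n)"
    unfolding block_eq[OF irr inf] using a(1) by (intro sum_mono2) (auto intro: nat_mono order_trans)
  also have "\<dots> \<le> block_sum x R (Suc m)" by (rule sum_block_le_block_sum[OF irr inf])
  finally have "int (nat (?b - a + 1) * nat a) \<le> int (block_sum x R (Suc m))" by (simp only: of_nat_le_iff)
  then show ?thesis using a a1 by simp
qed

lemma le_shifted_index:
  assumes "infinite (large_indices x R)"
  shows "m \<le> shifted_index x R m"
  using strict_mono_imp_increasing[OF strict_mono_shifted_index[OF assms]] .

text \<open>With q the end of the block, the following gap is at most the next continuant, hence at
  most q^\<tau>. The surplus \<epsilon> in the exponent of the block sum leaves q^(-\<epsilon>),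
  which sums because continuants grow exponentially.\<close>

lemma bounded_ratioI:
  assumes irr: "x \<notin> \<rat>" and "R \<ge> 1" "\<epsilon> > 0" "c > 0"
    and growth: "\<forall>\<^sub>F n in sequentially. real_of_int (continuant_aux x (Suc n)) \<le> real_of_int (continuant_aux x n) powr \<tau>"
    and block_sum: "infinite (large_indices x R) \<Longrightarrow>
      \<forall>\<^sub>F m in sequentially. c * real_of_int (block_end x R (Suc m)) powr (\<tau> + \<epsilon>) \<le> real (block_sum x R (Suc m))"
  shows "bounded_ratio x"
  unfolding bounded_ratio_def
proof (intro exI[of _ R] conjI impI)
  assume inf: "infinite (large_indices x R)"
  let ?Q = "\<lambda>n. real_of_int (continuant_aux x n)"
  obtain N where N: "\<And>n. n \<ge> N \<Longrightarrow> ?Q (Suc n) \<le> ?Q n powr \<tau>"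
    using growth by (auto simp: eventually_sequentially)
  show "summable (\<lambda>m. real_of_int (block_gap x R (Suc m)) / real (block_sum x R (Suc m)))"
  proof (rule summable_comparison_test_ev)
    show "summable (\<lambda>m. 1 / c * ?Q (Suc m) powr (- \<epsilon>))"
      by (intro summable_mult summable_continuant_aux_powr irr \<open>\<epsilon> > 0\<close>)
    show "\<forall>\<^sub>F m in sequentially. norm (real_of_int (block_gap x R (Suc m)) / real (block_sum x R (Suc m)))
        \<le> 1 / c * ?Q (Suc m) powr (- \<epsilon>)"
      using block_sum[OF inf] eventually_ge_at_top[of N]
    proof eventually_elim
      case (elim m)
      define n where "n = shifted_index x R (Suc m)"
      define q where "q = ?Q n"
      have n: "Suc m \<le> n" using le_shifted_index[OF inf] by (simp add: n_def)
      have q: "q = real_of_int (block_end x R (Suc m))" by (simp add: q_def n_def block_end_def)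
      have Q1: "?Q (Suc m) \<ge> 1" using continuant_aux_Suc_ge_1[OF irr, of m] by simp
      have Qq: "?Q (Suc m) \<le> q" unfolding q_def using monoD[OF mono_continuant_aux[OF irr] n] by simp
      have gap0: "block_gap x R (Suc m) \<ge> 0"
        using block_end_le_block_start[OF irr inf, of "Suc m"] by (simp add: block_gap_eq[OF irr inf])
      have "block_gap x R (Suc m) \<le> continuant_aux x (Suc n)"
        using block_start_le[OF irr inf, of "Suc m"] block_end_pos[OF irr inf, of m]
        by (simp add: block_gap_eq[OF irr inf] n_def)
      then have "real_of_int (block_gap x R (Suc m)) \<le> ?Q (Suc n)" by simp
      also have "\<dots> \<le> q powr \<tau>" unfolding q_def using elim n by (intro N) simp
      finally have gap: "real_of_int (block_gap x R (Suc m)) \<le> q powr \<tau>" .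
      have pos: "0 < c * q powr (\<tau> + \<epsilon>)" using \<open>c > 0\<close> Q1 Qq by simp
      have "real_of_int (block_gap x R (Suc m)) / real (block_sum x R (Suc m)) \<le> q powr \<tau> / (c * q powr (\<tau> + \<epsilon>))"
        using elim(1) gap gap0 pos unfolding q[symmetric] by (intro frac_le) auto
      also have "\<dots> = 1 / c * q powr (- \<epsilon>)"
        using Q1 Qq by (simp add: powr_add powr_minus divide_simps)
      also have "\<dots> \<le> 1 / c * ?Q (Suc m) powr (- \<epsilon>)"
        using Q1 Qq \<open>\<epsilon> > 0\<close> \<open>c > 0\<close> by (intro mult_left_mono powr_mono2') auto
      finally show ?case using gap0 by simp
    qed
  qed
qed fact

lemma powr_inverse_le:
  fixes X Y \<tau> :: real
  assumes "Y \<le> X powr \<tau>" "0 \<le> Y" "0 < X" "0 < \<tau>"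
  shows "Y powr (1 / \<tau>) \<le> X"
proof -
  have "Y powr (1 / \<tau>) \<le> (X powr \<tau>) powr (1 / \<tau>)"
    using assms by (intro powr_mono2) auto
  also have "\<dots> = X" using assms by (simp add: powr_powr)
  finally show ?thesis .
qed

text \<open>The top part of a block ending at q has sum of order at least q^(1 + 1 / \<tau>),
  because a continuant is at least the power 1 / \<tau> of the next one. This beats the gap q^\<tau>
  if \<tau> < 1 + 1 / \<tau>, that is, below the golden ratio.\<close>

lemma bounded_ratio_of_type_less_golden:
  assumes type: "diophantine_type x < ereal ((1 + sqrt 5) / 2)"
  shows "bounded_ratio x"
proof -
  have irr: "x \<notin> \<rat>" by (rule diophantine_type_less_imp_irrational[OF type])
  let ?Q = "\<lambda>n. real_of_int (continuant_aux x n)"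
  have "1 < sqrt 5" by simp
  then have "1 < (1 + sqrt 5) / 2" by simp
  with type obtain \<tau> where \<tau>: "1 < \<tau>" "\<tau> < (1 + sqrt 5) / 2"
    and growth: "\<forall>\<^sub>F n in sequentially. ?Q (Suc n) \<le> ?Q n powr \<tau>"
    by (rule diophantine_type_less_imp_growth)
  \<comment> \<open>Completes the square in \<tau>^2 < \<tau> + 1.\<close>
  have "(2 * \<tau> - 1) ^ 2 < sqrt 5 ^ 2" using \<tau> by (intro power_strict_mono) auto
  then have "\<tau> * \<tau> < \<tau> + 1" by (simp add: power2_eq_square algebra_simps)
  then have eps: "1 + 1 / \<tau> - \<tau> > 0" using \<tau> by (simp add: field_simps)
  show ?thesis
  \<comment> \<open>With R = 1 a partial quotient is either 1 or large, which the case distinctions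
    below exploit.\<close>
  proof (rule bounded_ratioI[OF irr, of 1 "1 + 1 / \<tau> - \<tau>" "(1 / 2) powr (1 + 1 / \<tau>)" \<tau>])
    assume inf: "infinite (large_indices x 1)"
    obtain N where N: "\<And>n. n \<ge> N \<Longrightarrow> ?Q (Suc n) \<le> ?Q n powr \<tau>"
      using growth by (auto simp: eventually_sequentially)
    have "(1 / 2) powr (1 + 1 / \<tau>) * real_of_int (block_end x 1 (Suc m)) powr (1 + 1 / \<tau>) \<le> real (block_sum x 1 (Suc m))"
      if m: "m \<ge> N + 2" for m
    proof -
      let ?\<kappa> = "shifted_index x 1"
      have "m + 1 \<le> ?\<kappa> (Suc m)" using le_shifted_index[OF inf, of "Suc m"] by simp
      then obtain k where k: "?\<kappa> (Suc m) = Suc (Suc k)" "k \<ge> N" "k \<ge> 1"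
        using m by (cases "?\<kappa> (Suc m)"; cases "?\<kappa> (Suc m) - 1") auto
      define q q1 q2 where "q = continuant_aux x (Suc (Suc k))" "q1 = continuant_aux x (Suc k)" "q2 = continuant_aux x k"
      note q_defs = this
      have "k = Suc (k - 1)" using k by simp
      then have pos: "q \<ge> 1" "q1 \<ge> 1" "q2 \<ge> 1"
        unfolding q_defs using continuant_aux_Suc_ge_1[OF irr] by metis+
      have q_end: "block_end x 1 (Suc m) = q" unfolding block_end_def k(1) q_defs ..
      have rec: "q = partial_quotient x (Suc k) * q1 + q2" by (simp add: q_defs continuant_aux.simps(3))
      have g1: "real_of_int q powr (1 / \<tau>) \<le> real_of_int q1" and g2: "real_of_int q1 powr (1 / \<tau>) \<le> real_of_int q2"
        using N[of "Suc k"] N[of k] k pos \<tau> unfolding q_defs by (auto intro!: powr_inverse_le)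
      have "?\<kappa> m < Suc (Suc k)" using strict_monoD[OF strict_mono_shifted_index[OF inf], of m "Suc m"] k by simp
      have start: "block_start x 1 m \<le> q1" if "?\<kappa> m \<noteq> Suc k"
      proof -
        have "Suc (?\<kappa> m) \<le> Suc k" using that \<open>?\<kappa> m < Suc (Suc k)\<close> by simp
        then show ?thesis
          using block_start_le[OF irr inf, of m] monoD[OF mono_continuant_aux[OF irr]] unfolding q_defs
          by (meson order_trans)
      qed
      have "(real_of_int q / 2) powr (1 + 1 / \<tau>) = (real_of_int q / 2) * (real_of_int q / 2) powr (1 / \<tau>)"
        using pos by (simp add: powr_add)
      also have "\<dots> \<le> real (block_sum x 1 (Suc m))"
      \<comment> \<open>If q \<ge> 2 q1, the top q1 + 1 numbers of the block are each at least q /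
        2, and q1 \<ge> q^(1 / \<tau>). Otherwise q = q1 + q2, and the q2 + 1 numbers from q1 to q
        serve, with q1 \<ge> q / 2 and q2 \<ge> q1^(1 / \<tau>).\<close>
      proof (cases "partial_quotient x (Suc k) \<ge> 2")
        case True
        have "2 * q1 \<le> partial_quotient x (Suc k) * q1" using True pos by (intro mult_right_mono) auto
        then have q1: "2 * q1 \<le> q" using rec pos by linarith
        \<comment> \<open>If the previous large index is the immediate predecessor, the block starts
          at q - R q1 with R = 1; otherwise it starts at q1 or earlier.\<close>
        have "block_start x 1 m \<le> q - q1"
        proof (cases "?\<kappa> m = Suc k")
          case True
          then show ?thesis by (simp add: block_start_def q_defs)
        qed (use start q1 in linarith)
        then have "(q - (q - q1) + 1) * (q - q1) \<le> int (block_sum x 1 (Suc m))"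
          using block_sum_ge[OF irr inf, of m "q - q1"] pos unfolding q_end by simp
        then have "real_of_int ((q1 + 1) * (q - q1)) \<le> real_of_int (int (block_sum x 1 (Suc m)))"
          unfolding of_int_le_iff by simp
        then have sum: "real_of_int (q1 + 1) * real_of_int (q - q1) \<le> real (block_sum x 1 (Suc m))"
          unfolding of_int_mult of_int_of_nat_eq .
        have "(real_of_int q / 2) powr (1 / \<tau>) \<le> real_of_int q powr (1 / \<tau>)"
          using pos \<tau> by (intro powr_mono2) auto
        also note g1
        finally have "(real_of_int q / 2) * (real_of_int q / 2) powr (1 / \<tau>) \<le> real_of_int (q - q1) * real_of_int (q1 + 1)"
          using pos q1 by (intro mult_mono) auto
        with sum show ?thesis by (simp add: mult.commute)
      next
        case False
        then have "partial_quotient x (Suc k) = 1" using partial_quotient_Suc_ge_1[OF irr, of k] by simp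
        then have q: "q = q1 + q2" using rec by simp
        have q12: "q2 \<le> q1" unfolding q_defs by (rule monoD[OF mono_continuant_aux[OF irr]]) simp
        \<comment> \<open>Otherwise k itself would be a large index, although the partial quotient
          after it is 1.\<close>
        have "?\<kappa> m \<noteq> Suc k"
        proof
          assume "?\<kappa> m = Suc k"
          moreover obtain j where "m = Suc j" using m by (cases m) auto
          ultimately have "k = enumerate (large_indices x 1) j" by (simp add: shifted_index_def)
          then have "k \<in> large_indices x 1" using enumerate_in_set[OF inf] by simp
          with False show False by (simp add: large_indices_def)
        qed
        then have "(q - q1 + 1) * q1 \<le> int (block_sum x 1 (Suc m))"
          using block_sum_ge[OF irr inf, of m q1] start pos unfolding q_end q by simp
        then have "real_of_int ((q2 + 1) * q1) \<le> real_of_int (int (block_sum x 1 (Suc m)))"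
          unfolding of_int_le_iff by (simp add: q)
        then have sum: "real_of_int (q2 + 1) * real_of_int q1 \<le> real (block_sum x 1 (Suc m))"
          unfolding of_int_mult of_int_of_nat_eq .
        have "(real_of_int q / 2) powr (1 / \<tau>) \<le> real_of_int q1 powr (1 / \<tau>)"
          using pos \<tau> q12 by (intro powr_mono2) (auto simp: q)
        also note g2
        finally have "(real_of_int q / 2) * (real_of_int q / 2) powr (1 / \<tau>) \<le> real_of_int q1 * real_of_int (q2 + 1)"
          using pos q12 by (intro mult_mono) (auto simp: q)
        with sum show ?thesis by (simp add: mult.commute)
      qed
      finally show ?thesis
        using pos unfolding q_end by (simp add: powr_mult[symmetric])
    qed
    then show "\<forall>\<^sub>F m in sequentially. (1 / 2) powr (1 + 1 / \<tau>) * real_of_int (block_end x 1 (Suc m)) powr (\<tau> + (1 + 1 / \<tau> - \<tau>))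
        \<le> real (block_sum x 1 (Suc m))"
      by (auto simp: eventually_sequentially)
  qed (use eps growth in auto)
qed

text \<open>The doubling condition puts the upper half of the numbers up to the block end b into the
  block, so its sum is at least b^2 / 4, against a gap of at most b^\<tau> with \<tau> < 2.\<close>

lemma bounded_ratio_of_type_less_2:
  assumes type: "diophantine_type x < 2" and "R \<ge> 1"
    and double: "infinite (large_indices x R) \<Longrightarrow> \<forall>\<^sub>F m in sequentially.
      continuant x (large_index x R m) \<ge> 2 * continuant x (large_index x R (m - 1) + 1)"
  shows "bounded_ratio x"
proof -
  have type': "diophantine_type x < ereal 2" using type unfolding numeral_eq_ereal .
  have irr: "x \<notin> \<rat>" by (rule diophantine_type_less_imp_irrational[OF type'])
  have "1 < (2::real)" by simp
  with type' obtain \<tau> where "1 < \<tau>" and \<tau>: "\<tau> < 2" and growth: "\<forall>\<^sub>F n in sequentially.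
      real_of_int (continuant_aux x (Suc n)) \<le> real_of_int (continuant_aux x n) powr \<tau>"
    by (rule diophantine_type_less_imp_growth)
  show ?thesis
  proof (rule bounded_ratioI[OF irr \<open>R \<ge> 1\<close> _ _ growth, of "2 - \<tau>" "1 / 4"])
    assume inf: "infinite (large_indices x R)"
    have "\<forall>\<^sub>F m in sequentially. continuant x (large_index x R (Suc m)) \<ge> 2 * continuant x (large_index x R m + 1)"
      using double[OF inf]
        eventually_sequentially_Suc[of "\<lambda>m. continuant x (large_index x R m) \<ge> 2 * continuant x (large_index x R (m - 1) + 1)"]
      by simp
    then show "\<forall>\<^sub>F m in sequentially. 1 / 4 * real_of_int (block_end x R (Suc m)) powr (\<tau> + (2 - \<tau>)) \<le> real (block_sum x R (Suc m))"
    proof eventually_elim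
      case (elim m)
      \<comment> \<open>Half of b rounded up: both a and the number b - a + 1 of elements from a on
        are at least b / 2.\<close>
      define b a where "b = block_end x R (Suc m)" and "a = (b + 1) div 2"
      have a: "b \<le> 2 * a" "2 * a \<le> b + 1" unfolding a_def by presburger+
      have b: "b \<ge> 1" unfolding b_def by (rule block_end_pos[OF irr inf])
      have "2 * continuant_aux x (Suc (shifted_index x R m)) \<le> b"
        using elim unfolding continuant_large_index block_end_def b_def .
      then have "block_start x R m \<le> a" using block_start_le[OF irr inf, of m] a by linarith
      moreover have "a \<le> b" using a b by linarith
      ultimately have "(b - a + 1) * a \<le> int (block_sum x R (Suc m))"
        unfolding b_def by (rule block_sum_ge[OF irr inf])
      then have "real_of_int ((b - a + 1) * a) \<le> real_of_int (int (block_sum x R (Suc m)))"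
        unfolding of_int_le_iff .
      then have sum: "real_of_int (b - a + 1) * real_of_int a \<le> real (block_sum x R (Suc m))"
        unfolding of_int_mult of_int_of_nat_eq .
      have "(real_of_int b / 2) * (real_of_int b / 2) \<le> real_of_int (b - a + 1) * real_of_int a"
        using a b by (intro mult_mono) linarith+
      also note sum
      also have "(real_of_int b / 2) * (real_of_int b / 2) = 1 / 4 * real_of_int b powr (\<tau> + (2 - \<tau>))"
        using b by (simp add: power2_eq_square)
      finally show ?case unfolding b_def .
    qed
  qed (use \<tau> in auto)
qed


section \<open>Divergence: overlaps of neighbourhoods of reduced fractions\<close>

text \<open>Each n is the sum of the totients of its divisors. Summed over n \<le> N, the totient of
  d occurs at most N / d times, while the total is N (N + 1) / 2.\<close>

lemma sum_totient_div_ge: "real N / 2 \<le> (\<Sum>q=1..N. real (totient q) / real q)"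
proof (cases "N = 0")
  case False
  have "real (N * N) \<le> 2 * real (\<Sum>n=1..N. n)"
    using gauss_sum_from_Suc_0[of N, where 'a = nat] by (simp add: real_of_nat_div)
  have "(\<Sum>n=1..N. n) = (\<Sum>n=1..N. \<Sum>d | d \<in> {1..N} \<and> d dvd n. totient d)"
  proof (rule sum.cong)
    fix n assume n: "n \<in> {1..N}"
    have "n = (\<Sum>d | d dvd n. totient d)" by (simp add: totient_divisor_sum)
    also have "{d. d dvd n} = {d. d \<in> {1..N} \<and> d dvd n}"
      using n by (auto intro: dvd_pos_nat dest: dvd_imp_le simp: Suc_le_eq)
    finally show "n = (\<Sum>d | d \<in> {1..N} \<and> d dvd n. totient d)" .
  qed simp
  also have "\<dots> = (\<Sum>d=1..N. \<Sum>n | n \<in> {1..N} \<and> d dvd n. totient d)"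
    by (rule sum.swap_restrict) auto
  also have "\<dots> = (\<Sum>d=1..N. totient d * (N div d))"
  proof (rule sum.cong)
    fix d assume d: "d \<in> {1..N}"
    have "{n. n \<in> {1..N} \<and> d dvd n} = (\<lambda>j. d * j) ` {1..N div d}"
      using d by (auto simp: dvd_def Suc_le_eq less_eq_div_iff_mult_less_eq mult.commute)
    moreover have "card ((\<lambda>j. d * j) ` {1..N div d}) = N div d"
      using d by (subst card_image) (auto simp: inj_on_def)
    ultimately show "(\<Sum>n | n \<in> {1..N} \<and> d dvd n. totient d) = totient d * (N div d)" by simp
  qed simp
  finally have "real (\<Sum>n=1..N. n) = (\<Sum>d=1..N. real (totient d) * real (N div d))" by simp
  also have "\<dots> \<le> (\<Sum>d=1..N. real (totient d) * (real N / real d))"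
    by (intro sum_mono mult_left_mono) (simp_all add: of_nat_div_le_of_nat)
  also have "\<dots> = real N * (\<Sum>d=1..N. real (totient d) / real d)"
    by (simp add: sum_distrib_left mult_ac)
  finally have "real N * real N \<le> real N * (2 * (\<Sum>d=1..N. real (totient d) / real d))"
    using \<open>real (N * N) \<le> 2 * real (\<Sum>n=1..N. n)\<close> by simp
  then have "real N \<le> 2 * (\<Sum>d=1..N. real (totient d) / real d)"
    using False by simp
  then show ?thesis by simp
qed simp

text \<open>Bernoulli's inequality replaces the power by its tangent at 1 / 2, which reduces the
  claim to the first moment.\<close>

lemma sum_totient_div_power_ge:
  "real N / 2 ^ n \<le> (\<Sum>q=1..N. (real (totient q) / real q) ^ n)"
proof -
  have bern: "1 + real n * (2 * u - 1) \<le> 2 ^ n * u ^ n" if "u \<ge> 0" for u :: real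
    using Bernoulli_inequality[of "2 * u - 1" n] that by (simp add: power_mult_distrib)
  have "real N \<le> (\<Sum>q=1..N. 1 + real n * (2 * (real (totient q) / real q) - 1))"
  proof -
    have "0 \<le> real n * (2 * (\<Sum>q=1..N. real (totient q) / real q) - N)"
      using sum_totient_div_ge[of N] by simp
    also have "\<dots> = real n * (\<Sum>q=1..N. 2 * (real (totient q) / real q) - 1)"
      by (simp add: sum_distrib_left sum_subtractf)
    also have "\<dots> = (\<Sum>q=1..N. real n * (2 * (real (totient q) / real q) - 1))"
      by (rule sum_distrib_left)
    finally show ?thesis by (simp add: sum.distrib)
  qed
  also have "\<dots> \<le> (\<Sum>q=1..N. 2 ^ n * (real (totient q) / real q) ^ n)"
    by (intro sum_mono bern) simp
  also have "\<dots> = 2 ^ n * (\<Sum>q=1..N. (real (totient q) / real q) ^ n)"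
    by (rule sum_distrib_left[symmetric])
  finally show ?thesis by (simp add: field_simps)
qed

text \<open>Abel summation: carries a bound on averages over to decreasing weights.\<close>

lemma sum_antimono_mult_nonneg:
  fixes f v :: "nat \<Rightarrow> real"
  assumes "antimono_on {1..} f" "\<And>q. q \<ge> 1 \<Longrightarrow> f q \<ge> 0" "\<And>N. 0 \<le> (\<Sum>q=1..N. v q)"
  shows "0 \<le> (\<Sum>q=1..N. f q * v q)"
proof -
  \<comment> \<open>The stronger form, with the last weight times the whole partial sum, is what
    passes through the induction.\<close>
  have "f N * (\<Sum>q=1..N. v q) \<le> (\<Sum>q=1..N. f q * v q)" if "N \<ge> 1" for N
    using that
  proof (induction N rule: nat_induct_at_least)
    case (Suc n)
    have "f (Suc n) \<le> f n" using Suc(1) assms(1) by (auto simp: monotone_on_def)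
    then have "f (Suc n) * (\<Sum>q=1..n. v q) \<le> f n * (\<Sum>q=1..n. v q)"
      by (rule mult_right_mono[OF _ assms(3)])
    with Suc show ?case by (simp add: algebra_simps)
  qed simp
  then show ?thesis
    using assms(2,3)[of N] by (cases "N \<ge> 1") (auto intro: order_trans[OF mult_nonneg_nonneg])
qed

text \<open>Reduced fractions give distinct centres for different q. Numerators run from 1 to q, so
  the set is not periodic and may reach beyond 1.\<close>

definition coprime_nbhd :: "nat \<Rightarrow> real \<Rightarrow> real set" where
  "coprime_nbhd q \<delta> = (\<Union>p\<in>totatives q. {(real p - \<delta>) / q<..<(real p + \<delta>) / q})"

lemma sets_coprime_nbhd [measurable]: "coprime_nbhd q \<delta> \<in> sets borel"
  unfolding coprime_nbhd_def by auto

lemma coprime_nbhd_near_int: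
  assumes "t \<in> coprime_nbhd q \<delta>"
  shows "near_int \<delta> (real q * t)"
proof -
  obtain p where p: "p \<in> totatives q" "(real p - \<delta>) / q < t" "t < (real p + \<delta>) / q"
    using assms by (auto simp: coprime_nbhd_def)
  have "q > 0" using p(1) by (auto simp: totatives_def intro: gr0I)
  then have "\<bar>real q * t - of_int (int p)\<bar> < \<delta>"
    using p(2,3) by (simp add: field_simps abs_less_iff)
  then show ?thesis unfolding near_int_def by blast
qed

lemma coprime_nbhd_subset:
  assumes "\<delta> \<le> 1"
  shows "coprime_nbhd q \<delta> \<subseteq> {0..2}"
proof
  fix t assume "t \<in> coprime_nbhd q \<delta>"
  then obtain p where p: "p \<in> totatives q" "(real p - \<delta>) / q < t" "t < (real p + \<delta>) / q"
    by (auto simp: coprime_nbhd_def)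
  have q: "1 \<le> p" "p \<le> q" using p(1) by (auto simp: totatives_def)
  have "0 \<le> (real p - \<delta>) / q" using q assms by simp
  moreover have "(real p + \<delta>) / q \<le> 2" using q assms by (simp add: field_simps)
  ultimately show "t \<in> {0..2}" using p by simp
qed

text \<open>The second moment argument needs the measure from below, hence the exact value; \<delta>
  \<le> 1 / 2 keeps the intervals disjoint.\<close>

lemma emeasure_coprime_nbhd:
  assumes "0 \<le> \<delta>" "\<delta> \<le> 1 / 2"
  shows "emeasure lborel (coprime_nbhd q \<delta>) = ennreal (2 * \<delta> * (real (totient q) / real q))"
proof -
  let ?I = "\<lambda>p::nat. {(real p - \<delta>) / q<..<(real p + \<delta>) / q}"
  have disj: "disjoint_family_on ?I (totatives q)"
    unfolding disjoint_family_on_def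
  proof (intro ballI impI)
    fix m n assume mn: "m \<in> totatives q" "n \<in> totatives q" "m \<noteq> n"
    then have "q > 0" by (auto simp: totatives_def intro: gr0I)
    have "\<not> (t \<in> ?I m \<and> t \<in> ?I n)" for t
    proof
      assume "t \<in> ?I m \<and> t \<in> ?I n"
      with \<open>q > 0\<close> have "\<bar>real m - real n\<bar> < 2 * \<delta>" by (simp add: field_simps abs_less_iff)
      with assms have "\<bar>real m - real n\<bar> < 1" by simp
      with mn(3) show False by linarith
    qed
    then show "?I m \<inter> ?I n = {}" by blast
  qed
  have "emeasure lborel (coprime_nbhd q \<delta>) = (\<Sum>p\<in>totatives q. emeasure lborel (?I p))"
    unfolding coprime_nbhd_def by (rule sum_emeasure[symmetric, OF _ disj]) auto
  also have "\<dots> = (\<Sum>p\<in>totatives q. ennreal (2 * \<delta> / q))"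
    using assms by (intro sum.cong refl, subst emeasure_lborel_Ioo) (auto simp: divide_right_mono simp flip: diff_divide_distrib)
  also have "\<dots> = ennreal (\<Sum>p\<in>totatives q. 2 * \<delta> / q)"
    using assms by (intro sum_ennreal) auto
  also have "(\<Sum>p\<in>totatives q. 2 * \<delta> / q) = 2 * \<delta> * (real (totient q) / real q)"
    by (simp add: totient_def)
  finally show ?thesis .
qed

text \<open>Excluding 0 removes the additive constant, so the count stays proportional to X even for
  small X.\<close>

lemma card_nonzero_int_abs_less:
  fixes X :: real
  shows "finite {t::int. t \<noteq> 0 \<and> \<bar>of_int t\<bar> < X}" "X \<ge> 0 \<Longrightarrow> real (card {t::int. t \<noteq> 0 \<and> \<bar>of_int t\<bar> < X}) \<le> 2 * X"
proof -
  define m where "m = \<lceil>X\<rceil> - 1"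
  have sub: "{t::int. t \<noteq> 0 \<and> \<bar>of_int t\<bar> < X} \<subseteq> {-m..-1} \<union> {1..m}" (is "?T \<subseteq> _")
    unfolding m_def by auto linarith+
  then show "finite ?T" by (rule finite_subset) simp
  assume "X \<ge> 0"
  have "card ?T \<le> card ({-m..-1} \<union> {1..m})" by (rule card_mono[OF _ sub]) simp
  also have "\<dots> \<le> card {-m..-1} + card {1..m}" by (rule card_Un_le)
  also have "\<dots> = 2 * nat m" by simp
  finally have "real (card ?T) \<le> 2 * real (nat m)" by simp
  also have "real (nat m) \<le> X" using \<open>X \<ge> 0\<close> unfolding m_def by linarith
  finally show "real (card ?T) \<le> 2 * X" by simp
qed

text \<open>With g the gcd of q and r, p r - s q is g times an integer h of absolute value below H /
  g, nonzero because the two reduced fractions differ. Each h comes from at most g pairs, since it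
  fixes p modulo q / g.\<close>

lemma card_close_totatives:
  fixes H :: real
  assumes "q \<ge> 1" "r \<ge> 1" "q \<noteq> r" "H \<ge> 0"
  shows "real (card {(p, s). p \<in> totatives q \<and> s \<in> totatives r \<and> \<bar>real p * r - real s * q\<bar> < H}) \<le> 2 * H"
    (is "real (card ?K) \<le> _")
proof -
  define g where "g = gcd q r"
  define q' where "q' = q div g"
  define r' where "r' = r div g"
  have g: "g > 0" using assms by (simp add: g_def)
  have q: "q = q' * g" and r: "r = r' * g" by (simp_all add: g_def q'_def r'_def)
  have cop: "coprime q' r'" unfolding q'_def r'_def g_def using assms by (intro div_gcd_coprime) auto
  have q': "q' > 0" using assms(1) q by (auto intro: gr0I)
  let ?T = "{t::int. t \<noteq> 0 \<and> \<bar>of_int t\<bar> < H / g}"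
  define h :: "nat \<times> nat \<Rightarrow> int" where "h = (\<lambda>(p, s). int p * int r' - int s * int q')"
  have hg: "h (p, s) * int g = int p * int r - int s * int q" for p s
    by (simp add: h_def q r algebra_simps)
  \<comment> \<open>The second component tells which of the g runs of length \<open>q'\<close> in 1,
    ..., q contains p; numbering from 1 explains the p - 1.\<close>
  let ?f = "\<lambda>z. (h z, (fst z - 1) div q')"
  have inj: "inj_on ?f ?K"
  proof (rule inj_onI, clarify)
    fix p s p1 s1
    assume K: "p \<in> totatives q" "s \<in> totatives r" "p1 \<in> totatives q" "s1 \<in> totatives r"
      and heq: "h (p, s) = h (p1, s1)" and div: "(fst (p, s) - 1) div q' = (fst (p1, s1) - 1) div q'"
    have pos: "p \<ge> 1" "p1 \<ge> 1" using K by (auto simp: totatives_def)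
    have "(int p - int p1) * int r' = (int s - int s1) * int q'"
      using heq by (simp add: h_def algebra_simps)
    then have "int q' dvd (int p - int p1) * int r'" by simp
    then have "int q' dvd int p - int p1"
      using cop by (simp add: coprime_dvd_mult_left_iff)
    then have "int q' dvd int (p - 1) - int (p1 - 1)" using pos by (simp add: of_nat_diff)
    then have "(p - 1) mod q' = (p1 - 1) mod q'"
      by (metis mod_eq_dvd_iff of_nat_eq_iff of_nat_mod)
    with div have "p - 1 = p1 - 1" by (metis div_mult_mod_eq fst_conv)
    with pos have p: "p = p1" by simp
    with heq q' show "p = p1 \<and> s = s1" by (simp add: h_def)
  qed
  have sub: "?f ` ?K \<subseteq> ?T \<times> {..<g}"
  proof
    fix z assume "z \<in> ?f ` ?K"
    then obtain p s where K: "p \<in> totatives q" "s \<in> totatives r"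
      and less: "\<bar>real p * r - real s * q\<bar> < H" and z: "z = (h (p, s), (p - 1) div q')"
      by auto
    have "\<bar>real_of_int (h (p, s))\<bar> * g = \<bar>real_of_int (h (p, s) * int g)\<bar>" by (simp add: abs_mult)
    also have "\<dots> < H" using less unfolding hg by simp
    finally have 1: "\<bar>real_of_int (h (p, s))\<bar> < H / g" using g by (simp add: field_simps)
    have "p \<le> q" "p \<ge> 1" using K by (auto simp: totatives_def)
    then have 2: "(p - 1) div q' < g"
      using q' by (simp add: less_mult_imp_div_less q mult.commute)
    \<comment> \<open>Equal reduced fractions would have equal denominators.\<close>
    have 3: "h (p, s) \<noteq> 0"
    proof
      assume "h (p, s) = 0"
      then have "int (p * r) = int (s * q)" using hg[of p s] by simp
      then have eq: "p * r = s * q" by (simp only: of_nat_eq_iff)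
      have "coprime q p" "coprime r s" using K by (auto simp: totatives_def coprime_commute)
      moreover have "q dvd p * r" "r dvd s * q" using eq by (metis dvd_triv_right)+
      ultimately have "q dvd r" "r dvd q" by (simp_all add: coprime_dvd_mult_right_iff)
      then show False using assms(3) dvd_antisym by blast
    qed
    show "z \<in> ?T \<times> {..<g}" using 1 2 3 by (simp add: z)
  qed
  have "card ?K = card (?f ` ?K)" by (rule card_image[OF inj, symmetric])
  also have "\<dots> \<le> card (?T \<times> {..<g})"
    by (rule card_mono[OF _ sub]) (simp add: card_nonzero_int_abs_less(1))
  finally have "real (card ?K) \<le> real (card ?T) * g" by (simp add: card_cartesian_product flip: of_nat_mult)
  also have "\<dots> \<le> 2 * (H / g) * g"
    using assms(4) by (intro mult_right_mono card_nonzero_int_abs_less) auto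
  finally show ?thesis using g by simp
qed

text \<open>By \<open>le\<close> the intervals about the p / q are the shorter ones. They cover the
  overlap, and only those p / q matter that are closer to some s / r than the sum of the radii;
  \<open>H\<close> is this sum times q r.\<close>

lemma emeasure_coprime_nbhd_Int_aux:
  fixes \<delta> \<epsilon> :: real
  assumes "q \<ge> 1" "r \<ge> 1" "q \<noteq> r" "\<delta> \<ge> 0" "\<epsilon> \<ge> 0" and le: "\<delta> * r \<le> \<epsilon> * q"
  shows "emeasure lborel (coprime_nbhd q \<delta> \<inter> coprime_nbhd r \<epsilon>) \<le> ennreal (8 * \<delta> * \<epsilon>)"
proof -
  define H where "H = \<delta> * r + \<epsilon> * q"
  let ?K = "{(p, s). p \<in> totatives q \<and> s \<in> totatives r \<and> \<bar>real p * r - real s * q\<bar> < H}"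
  let ?I = "\<lambda>z::nat \<times> nat. {(real (fst z) - \<delta>) / q<..<(real (fst z) + \<delta>) / q}"
  have fin: "finite ?K"
    by (rule finite_subset[of _ "totatives q \<times> totatives r"]) auto
  have "coprime_nbhd q \<delta> \<inter> coprime_nbhd r \<epsilon> \<subseteq> (\<Union>z\<in>?K. ?I z)"
  proof
    fix t assume "t \<in> coprime_nbhd q \<delta> \<inter> coprime_nbhd r \<epsilon>"
    then obtain p s where p: "p \<in> totatives q" "(real p - \<delta>) / q < t" "t < (real p + \<delta>) / q"
      and s: "s \<in> totatives r" "(real s - \<epsilon>) / r < t" "t < (real s + \<epsilon>) / r"
      by (auto simp: coprime_nbhd_def)
    have qr: "0 < real q" "0 < real r" using assms by auto
    have pt: "\<bar>real p - q * t\<bar> < \<delta>" "\<bar>r * t - real s\<bar> < \<epsilon>"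
      using p s qr by (auto simp: field_simps abs_less_iff)
    have "real p * r - real s * q = r * (real p - q * t) + q * (r * t - real s)" by (simp add: algebra_simps)
    also have "\<bar>\<dots>\<bar> \<le> r * \<bar>real p - q * t\<bar> + q * \<bar>r * t - real s\<bar>"
      by (rule order_trans[OF abs_triangle_ineq]) (simp add: abs_mult)
    also have "\<dots> < r * \<delta> + q * \<epsilon>"
      using pt qr by (intro add_strict_mono mult_strict_left_mono) auto
    finally have "(p, s) \<in> ?K" using p s by (simp add: H_def mult.commute)
    moreover have "t \<in> ?I (p, s)" using p by simp
    ultimately show "t \<in> (\<Union>z\<in>?K. ?I z)" by blast
  qed
  then have "emeasure lborel (coprime_nbhd q \<delta> \<inter> coprime_nbhd r \<epsilon>) \<le> emeasure lborel (\<Union>z\<in>?K. ?I z)"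
    by (intro emeasure_mono) auto
  also have "\<dots> \<le> (\<Sum>z\<in>?K. emeasure lborel (?I z))"
    by (rule emeasure_subadditive_finite[OF fin]) auto
  also have "\<dots> = (\<Sum>z\<in>?K. ennreal (2 * \<delta> / q))"
    using assms by (intro sum.cong refl, subst emeasure_lborel_Ioo) (auto simp: divide_right_mono simp flip: diff_divide_distrib)
  also have "\<dots> = ennreal (\<Sum>z\<in>?K. 2 * \<delta> / q)"
    using assms by (intro sum_ennreal) auto
  also have "\<dots> \<le> ennreal (8 * \<delta> * \<epsilon>)"
  proof (rule ennreal_leI)
    have "(\<Sum>z\<in>?K. 2 * \<delta> / q) = real (card ?K) * (2 * \<delta> / q)" by simp
    also have "\<dots> \<le> (2 * H) * (2 * \<delta> / q)"
      using assms by (intro mult_right_mono card_close_totatives) (auto simp: H_def)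
    \<comment> \<open>\<open>H\<close> is at most twice its larger term, after which q
      cancels.\<close>
    also have "\<dots> \<le> (2 * (2 * (\<epsilon> * q))) * (2 * \<delta> / q)"
      using assms by (intro mult_right_mono) (auto simp: H_def)
    also have "\<dots> = 8 * \<delta> * \<epsilon>" using assms by simp
    finally show "(\<Sum>z\<in>?K. 2 * \<delta> / q) \<le> 8 * \<delta> * \<epsilon>" .
  qed
  finally show ?thesis .
qed

lemma emeasure_coprime_nbhd_Int:
  fixes \<delta> \<epsilon> :: real
  assumes "q \<ge> 1" "r \<ge> 1" "q \<noteq> r" "\<delta> \<ge> 0" "\<epsilon> \<ge> 0"
  shows "emeasure lborel (coprime_nbhd q \<delta> \<inter> coprime_nbhd r \<epsilon>) \<le> ennreal (8 * \<delta> * \<epsilon>)"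
  using emeasure_coprime_nbhd_Int_aux[of q r \<delta> \<epsilon>] emeasure_coprime_nbhd_Int_aux[of r q \<epsilon> \<delta>] assms
  by (cases "\<delta> * r \<le> \<epsilon> * q") (auto simp: Int_commute mult_ac)


section \<open>Divergence: second moments\<close>

text \<open>The Chung-Erdos inequality, i.e. Cauchy-Schwarz for the counting function f, which is
  supported on the union U. It is derived from (f - l 1_U)^2 having nonnegative integral for every
  l.\<close>

lemma second_moment_union:
  fixes A :: "'i \<Rightarrow> 'a set"
  assumes J: "finite J" and A: "\<And>i. i \<in> J \<Longrightarrow> A i \<in> sets M" "\<And>i. i \<in> J \<Longrightarrow> emeasure M (A i) < \<infinity>"
  shows "(\<Sum>i\<in>J. measure M (A i)) ^ 2 \<le>
    (\<Sum>i\<in>J. \<Sum>j\<in>J. measure M (A i \<inter> A j)) * measure M (\<Union>i\<in>J. A i)"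
proof -
  define U where "U = (\<Union>i\<in>J. A i)"
  define S where "S = (\<Sum>i\<in>J. measure M (A i))"
  define Q where "Q = (\<Sum>i\<in>J. \<Sum>j\<in>J. measure M (A i \<inter> A j))"
  define u where "u = measure M U"
  have fm: "A i \<in> fmeasurable M" if "i \<in> J" for i
    using A that by (intro fmeasurableI) auto
  then have U: "U \<in> fmeasurable M" unfolding U_def by (intro fmeasurable.finite_UN J) auto
  have int: "integrable M (indicat_real B)" if "B \<in> fmeasurable M" for B
    using that by (auto simp: fmeasurable_def)
  have AA: "A i \<inter> A j \<in> fmeasurable M" if "i \<in> J" "j \<in> J" for i j
    using fm that by (intro fmeasurable.Int) auto
  define f where "f x = (\<Sum>i\<in>J. indicat_real (A i) x)" for x
  have f2: "f x ^ 2 = (\<Sum>i\<in>J. \<Sum>j\<in>J. indicat_real (A i \<inter> A j) x)" for x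
    by (simp add: f_def power2_eq_square sum_product indicator_inter_arith)
  have fU: "f x * indicat_real U x = f x" for x
    by (cases "x \<in> U") (auto simp: f_def U_def indicator_def)
  have int_f2: "integrable M (\<lambda>x. f x ^ 2)"
    unfolding f2 using int AA by (intro Bochner_Integration.integrable_sum) auto
  have int_U: "integrable M (\<lambda>x. l ^ 2 * indicat_real U x)" for l
    using int U by (intro integrable_mult_right) auto
  have key: "2 * l * S \<le> Q + l ^ 2 * u" for l
  proof -
    have "(\<integral>x. f x \<partial>M) = (\<Sum>i\<in>J. \<integral>x. indicat_real (A i) x \<partial>M)"
      unfolding f_def using int fm by (intro Bochner_Integration.integral_sum) auto
    also have "\<dots> = S"
      unfolding S_def using fm by (intro sum.cong refl) (auto simp: fmeasurable_def)
    finally have "2 * l * S = (\<integral>x. 2 * l * f x \<partial>M)" by simp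
    also have "\<dots> \<le> (\<integral>x. f x ^ 2 + l ^ 2 * indicat_real U x \<partial>M)"
    proof (rule integral_mono)
      show "integrable M (\<lambda>x. 2 * l * f x)"
        unfolding f_def using int fm by (intro integrable_mult_right integrable_sum) auto
      show "integrable M (\<lambda>x. f x ^ 2 + l ^ 2 * indicat_real U x)"
        using int_f2 int_U by (rule Bochner_Integration.integrable_add)
      fix x
      have "0 \<le> (f x - l * indicat_real U x) ^ 2" by simp
      also have "\<dots> = f x ^ 2 - 2 * l * (f x * indicat_real U x) + l ^ 2 * (indicat_real U x) ^ 2"
        by (simp add: power2_eq_square algebra_simps)
      also have "(indicat_real U x) ^ 2 = indicat_real U x" by (simp add: indicator_def)
      finally show "2 * l * f x \<le> f x ^ 2 + l ^ 2 * indicat_real U x" unfolding fU by simp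
    qed
    also have "\<dots> = (\<integral>x. f x ^ 2 \<partial>M) + l ^ 2 * u"
      using Bochner_Integration.integral_add[OF int_f2 int_U] U
      by (simp add: u_def fmeasurable_def)
    also have "(\<integral>x. f x ^ 2 \<partial>M) = Q"
    proof -
      have "(\<integral>x. f x ^ 2 \<partial>M) = (\<Sum>i\<in>J. \<integral>x. (\<Sum>j\<in>J. indicat_real (A i \<inter> A j) x) \<partial>M)"
        unfolding f2 using int AA by (intro Bochner_Integration.integral_sum integrable_sum) auto
      also have "\<dots> = (\<Sum>i\<in>J. \<Sum>j\<in>J. \<integral>x. indicat_real (A i \<inter> A j) x \<partial>M)"
        using int AA by (intro sum.cong refl Bochner_Integration.integral_sum) auto
      also have "\<dots> = Q"
        unfolding Q_def using AA by (intro sum.cong refl) (auto simp: fmeasurable_def)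
      finally show ?thesis .
    qed
    finally show ?thesis .
  qed
  have S0: "S \<ge> 0" and u0: "u \<ge> 0" and Q0: "Q \<ge> 0" by (simp_all add: S_def u_def Q_def sum_nonneg)
  have "S ^ 2 \<le> Q * u"
  proof (cases "u = 0")
    case True
    have "measure M (A i) \<le> u" if "i \<in> J" for i
      unfolding u_def using that fm U A by (intro measure_mono_fmeasurable) (auto simp: U_def)
    then have "S \<le> 0" unfolding S_def True by (intro sum_nonpos) auto
    then show ?thesis using S0 True by simp
  next
    case False
    then have "u > 0" using u0 by simp
    \<comment> \<open>l = S / u is the optimal choice in \<open>key\<close>.\<close>
    have "2 * (S / u) * S \<le> Q + (S / u) ^ 2 * u" by (rule key)
    then have "(2 * (S / u) * S) * u \<le> (Q + (S / u) ^ 2 * u) * u"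
      using u0 by (rule mult_right_mono)
    then show ?thesis using \<open>u > 0\<close> by (simp add: power2_eq_square field_simps)
  qed
  then show ?thesis by (simp add: S_def Q_def u_def U_def)
qed

text \<open>The limsup set is the decreasing intersection of tail unions; these lie in \<Omega> of
  finite measure, so continuity from above applies.\<close>

lemma limsup_not_null:
  fixes A :: "nat \<Rightarrow> 'a set"
  assumes A: "\<And>q. A q \<in> sets M" and \<Omega>: "\<Omega> \<in> fmeasurable M" "\<And>q. q \<ge> q0 \<Longrightarrow> A q \<subseteq> \<Omega>" and "c > 0"
    and large: "\<And>m. m \<ge> q0 \<Longrightarrow> \<exists>N. c \<le> measure M (\<Union>q\<in>{m..N}. A q)"
  shows "{y. infinite {q. y \<in> A q}} \<notin> null_sets M"
proof
  define B where "B m = (\<Union>q\<in>{m + q0..}. A q)" for m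
  have B: "B m \<in> sets M" "B m \<subseteq> \<Omega>" for m
    using A by (auto simp: B_def) (meson \<Omega>(2) le_add2 order_trans subsetD)
  have Bf: "B m \<in> fmeasurable M" for m
    by (rule fmeasurableI2[OF \<Omega>(1) B(2) B(1)])
  have "(\<lambda>m. measure M (B m)) \<longlonglongrightarrow> measure M (\<Inter>m. B m)"
  proof (rule Lim_measure_decseq)
    show "range B \<subseteq> sets M" using B by auto
    show "decseq B" unfolding B_def by (intro decseq_SucI UN_mono) auto
    show "emeasure M (B m) \<noteq> \<infinity>" for m using Bf[of m] by (auto simp: fmeasurable_def)
  qed
  moreover have "c \<le> measure M (B m)" for m
  proof -
    obtain N where "c \<le> measure M (\<Union>q\<in>{m + q0..N}. A q)" using large[of "m + q0"] by auto
    also have "\<dots> \<le> measure M (B m)"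
      using A Bf by (intro measure_mono_fmeasurable) (auto simp: B_def)
    finally show ?thesis .
  qed
  ultimately have "c \<le> measure M (\<Inter>m. B m)" by (intro LIMSEQ_le_const) auto
  assume "{y. infinite {q. y \<in> A q}} \<in> null_sets M"
  moreover have "(\<Inter>m. B m) \<subseteq> {y. infinite {q. y \<in> A q}}"
  proof
    fix y assume y: "y \<in> (\<Inter>m. B m)"
    have "\<exists>n>m. n \<in> {q. y \<in> A q}" for m
    proof -
      have "y \<in> B (Suc m)" using y by blast
      then obtain q where "q \<ge> Suc m + q0" "y \<in> A q" by (auto simp: B_def)
      then show ?thesis by (intro exI[of _ q]) auto
    qed
    then show "y \<in> {y. infinite {q. y \<in> A q}}" by (simp add: infinite_nat_iff_unbounded)
  qed
  moreover have "(\<Inter>m. B m) \<in> sets M" using B by auto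
  ultimately have "(\<Inter>m. B m) \<in> null_sets M" by (metis null_sets_subset)
  then have "measure M (\<Inter>m. B m) = 0" by (simp add: measure_eq_0_null_sets)
  with \<open>c \<le> measure M (\<Inter>m. B m)\<close> \<open>c > 0\<close> show False by simp
qed

text \<open>The points with all coordinates near reduced fractions of denominator q form sets A q
  whose overlaps are at most a constant times u q u r and whose measures add up to the order of the
  sum of u. The second moment inequality then bounds the unions of long stretches from below
  uniformly.\<close>

lemma khintchine_divergence:
  fixes \<delta> :: "nat \<Rightarrow> real"
  defines "n \<equiv> DIM('a::euclidean_space)"
  assumes anti: "antimono_on {1..} \<delta>" and nonneg: "\<And>q. q \<ge> 1 \<Longrightarrow> \<delta> q \<ge> 0"
    and small: "\<forall>\<^sub>F q in sequentially. \<delta> q \<le> 1 / 2"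
    and div: "\<not> summable (\<lambda>q. \<delta> q ^ n)"
  shows "{y :: 'a. infinite {q. q \<ge> 1 \<and> (\<forall>b\<in>Basis. near_int (\<delta> q) (real q * (y \<bullet> b)))}} \<notin> null_sets lebesgue"
proof
  define A :: "nat \<Rightarrow> 'a set" where "A q = {y. \<forall>b\<in>Basis. y \<bullet> b \<in> coprime_nbhd q (\<delta> q)}" for q
  define u where "u q = \<delta> q ^ n" for q
  define w where "w q = (real (totient q) / real q) ^ n" for q
  obtain q1 where q1: "\<And>q. q \<ge> q1 \<Longrightarrow> \<delta> q \<le> 1 / 2"
    using small by (auto simp: eventually_sequentially)
  define q0 where "q0 = max q1 1"
  have q0: "\<delta> q \<le> 1 / 2" "\<delta> q \<ge> 0" "q \<ge> 1" if "q \<ge> q0" for q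
    using that q1 nonneg by (auto simp: q0_def)
  have u: "u q \<ge> 0" if "q \<ge> 1" for q using nonneg[OF that] by (simp add: u_def)
  have w: "0 \<le> w q" "w q \<le> 1" for q
  proof -
    have "real (totient q) / real q \<le> 1" using totient_le[of q] by (cases "q = 0") auto
    then show "w q \<le> 1" unfolding w_def by (intro power_le_one) auto
  qed (simp add: w_def)
  have A: "A q \<in> sets borel" for q unfolding A_def by (rule sets_borel_cube) simp
  have em: "emeasure lborel (A q) = ennreal (2 ^ n * (u q * w q))" if "q \<ge> q0" for q
  proof -
    have "emeasure lborel (A q) = ennreal (2 * \<delta> q * (real (totient q) / real q)) ^ n"
      unfolding A_def n_def using q0[OF that]
      by (simp add: emeasure_lborel_cube emeasure_coprime_nbhd)
    also have "\<dots> = ennreal ((2 * \<delta> q * (real (totient q) / real q)) ^ n)"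
      using q0[OF that] by (intro ennreal_power) auto
    also have "(2 * \<delta> q * (real (totient q) / real q)) ^ n = 2 ^ n * (u q * w q)"
      unfolding u_def w_def by (simp only: power_mult_distrib mult.assoc)
    finally show ?thesis .
  qed
  have m: "measure lborel (A q) = 2 ^ n * (u q * w q)" if "q \<ge> q0" for q
    using em[OF that] u[of q] w(1)[of q] q0[OF that] by (simp add: measure_def)
  have overlap: "measure lborel (A q \<inter> A r) \<le> 8 ^ n * (u q * u r)" if "q \<ge> q0" "r \<ge> q0" "q \<noteq> r" for q r
  proof -
    have "A q \<inter> A r = {y. \<forall>b\<in>Basis. y \<bullet> b \<in> coprime_nbhd q (\<delta> q) \<inter> coprime_nbhd r (\<delta> r)}"
      by (auto simp: A_def)
    then have "emeasure lborel (A q \<inter> A r) = emeasure lborel (coprime_nbhd q (\<delta> q) \<inter> coprime_nbhd r (\<delta> r)) ^ n"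
      unfolding n_def by (simp only:) (rule emeasure_lborel_cube, simp)
    also have "\<dots> \<le> ennreal (8 * \<delta> q * \<delta> r) ^ n"
      using that q0[of q] q0[of r] by (intro power_mono emeasure_coprime_nbhd_Int) auto
    also have "\<dots> = ennreal ((8 * \<delta> q * \<delta> r) ^ n)"
      using that q0[of q] q0[of r] by (intro ennreal_power) auto
    also have "(8 * \<delta> q * \<delta> r) ^ n = 8 ^ n * (u q * u r)"
      unfolding u_def by (simp only: power_mult_distrib mult.assoc)
    finally show ?thesis
      using that u[of q] u[of r] q0[of q] q0[of r] by (simp add: measure_def enn2real_leI)
  qed
  \<comment> \<open>\<open>w q\<close> can be small for individual q, but its average is bounded
    below and u is decreasing.\<close>
  have avg: "(\<Sum>q=1..N. u q) / 2 ^ n \<le> (\<Sum>q=1..N. u q * w q)" for N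
  proof -
    have "0 \<le> (\<Sum>q=1..N. u q * (w q - 1 / 2 ^ n))"
    proof (rule sum_antimono_mult_nonneg)
      show "antimono_on {1..} u"
        using anti nonneg by (auto simp: monotone_on_def u_def intro!: power_mono)
      show "0 \<le> (\<Sum>q=1..N. w q - 1 / 2 ^ n)" for N
        using sum_totient_div_power_ge[of N n] by (simp add: w_def sum_subtractf)
    qed (rule u)
    then show ?thesis by (simp add: algebra_simps sum_subtractf sum_divide_distrib)
  qed
  have unbounded: "\<exists>N. K < (\<Sum>q=1..N. u q)" for K
  proof (rule ccontr)
    assume "\<nexists>N. K < (\<Sum>q=1..N. u q)"
    then have le: "(\<Sum>q=1..N. u q) \<le> K" for N by (simp add: not_less)
    have "summable (\<lambda>q. u (Suc q))"
    proof (rule summableI_nonneg_bounded)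
      show "0 \<le> u (Suc q)" for q by (rule u) simp
      show "(\<Sum>i<N. u (Suc i)) \<le> K" for N
        using le[of N] by (simp add: sum.atLeast1_atMost_eq)
    qed
    then have "summable u" by (simp only: summable_Suc_iff)
    with div show False by (simp add: u_def[abs_def])
  qed
  \<comment> \<open>Results from (S / 2)^2 \<le> (8^n + 2^n) S^2 times the measure of the
    union.\<close>
  define c where "c = 1 / (4 * (8 ^ n + 2 ^ n :: real))"
  have large: "\<exists>N. c \<le> measure lborel (\<Union>q\<in>{m..N}. A q)" if "m \<ge> q0" for m
  proof -
    define C where "C = 2 ^ n * (\<Sum>q=1..<m. u q * w q)"
    \<comment> \<open>The three bounds ensure S \<le> S^2, which absorbs the diagonal terms; C \<le>
      S / 2, so that dropping the sets before m keeps half of S; and N \<ge> m.\<close>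
    obtain N where N: "max (max 1 (2 * C)) (\<Sum>q=1..m. u q) < (\<Sum>q=1..N. u q)"
      using unbounded by blast
    define S where "S = (\<Sum>q=1..N. u q)"
    have S: "S \<ge> 1" "2 * C \<le> S" using N by (auto simp: S_def)
    have "m \<le> N"
    proof (rule ccontr)
      assume "\<not> m \<le> N"
      then have "(\<Sum>q=1..N. u q) \<le> (\<Sum>q=1..m. u q)" using u by (intro sum_mono2) auto
      with N show False by simp
    qed
    have m1: "m \<ge> 1" using that by (simp add: q0_def)
    let ?J = "{m..N}"
    have split: "(\<Sum>q=1..N. u q * w q) = (\<Sum>q=1..<m. u q * w q) + (\<Sum>q\<in>?J. u q * w q)"
      using \<open>m \<le> N\<close> m1 by (simp add: atLeastLessThanSuc_atLeastAtMost[symmetric] sum.atLeastLessThan_concat)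
    have "S \<le> 2 ^ n * (\<Sum>q=1..N. u q * w q)"
      using avg[of N] by (simp add: S_def field_simps)
    also have "\<dots> = C + (\<Sum>q\<in>?J. measure lborel (A q))"
      unfolding split C_def using that m by (simp add: distrib_left sum_distrib_left)
    finally have lower: "S / 2 \<le> (\<Sum>q\<in>?J. measure lborel (A q))" using S by simp
    have "(\<Sum>q\<in>?J. \<Sum>r\<in>?J. measure lborel (A q \<inter> A r)) \<le>
      (\<Sum>q\<in>?J. \<Sum>r\<in>?J. 8 ^ n * (u q * u r) + (if r = q then 2 ^ n * u q else 0))"
    proof (intro sum_mono)
      fix q r assume qr: "q \<in> ?J" "r \<in> ?J"
      then have "q \<ge> q0" "r \<ge> q0" using that by auto
      show "measure lborel (A q \<inter> A r) \<le> 8 ^ n * (u q * u r) + (if r = q then 2 ^ n * u q else 0)"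
      proof (cases "r = q")
        case True
        have "u q * w q \<le> u q * 1" using u[of q] w[of q] q0[OF \<open>q \<ge> q0\<close>] by (intro mult_left_mono) auto
        then show ?thesis using True m[OF \<open>q \<ge> q0\<close>] by (simp add: add_increasing)
      qed (use overlap[OF \<open>q \<ge> q0\<close> \<open>r \<ge> q0\<close>] in auto)
    qed
    also have "\<dots> = 8 ^ n * (\<Sum>q\<in>?J. u q) ^ 2 + 2 ^ n * (\<Sum>q\<in>?J. u q)"
    proof -
      have "(\<Sum>q\<in>?J. \<Sum>r\<in>?J. 8 ^ n * (u q * u r)) = 8 ^ n * (\<Sum>q\<in>?J. \<Sum>r\<in>?J. u q * u r)"
        by (simp only: sum_distrib_left)
      also have "(\<Sum>q\<in>?J. \<Sum>r\<in>?J. u q * u r) = (\<Sum>q\<in>?J. u q) ^ 2"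
        by (simp only: power2_eq_square sum_product)
      finally show ?thesis by (simp add: sum.distrib sum_distrib_left)
    qed
    also have "\<dots> \<le> 8 ^ n * S ^ 2 + 2 ^ n * S"
    proof -
      have "(\<Sum>q\<in>?J. u q) \<le> S" unfolding S_def using m1 u by (intro sum_mono2) auto
      moreover have "0 \<le> (\<Sum>q\<in>?J. u q)" using m1 u by (intro sum_nonneg) auto
      ultimately show ?thesis by (intro add_mono mult_left_mono power_mono) auto
    qed
    also have "\<dots> \<le> (8 ^ n + 2 ^ n) * S ^ 2"
      using S by (simp add: distrib_right power2_eq_square)
    finally have upper: "(\<Sum>q\<in>?J. \<Sum>r\<in>?J. measure lborel (A q \<inter> A r)) \<le> (8 ^ n + 2 ^ n) * S ^ 2" .
    have "(S / 2) ^ 2 \<le> (\<Sum>q\<in>?J. measure lborel (A q)) ^ 2"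
      using lower S by (intro power_mono) auto
    also have "\<dots> \<le> (\<Sum>q\<in>?J. \<Sum>r\<in>?J. measure lborel (A q \<inter> A r)) * measure lborel (\<Union>q\<in>?J. A q)"
      using A em that by (intro second_moment_union) auto
    also have "\<dots> \<le> ((8 ^ n + 2 ^ n) * S ^ 2) * measure lborel (\<Union>q\<in>?J. A q)"
      by (intro mult_right_mono upper) simp
    finally have "S ^ 2 * 1 \<le> S ^ 2 * (4 * (8 ^ n + 2 ^ n) * measure lborel (\<Union>q\<in>?J. A q))"
      by (simp add: power_divide algebra_simps)
    then have "1 \<le> 4 * (8 ^ n + 2 ^ n) * measure lborel (\<Union>q\<in>?J. A q)"
      using S(1) by (subst (asm) mult_le_cancel_left_pos) auto
    then have "c \<le> measure lborel (\<Union>q\<in>?J. A q)"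
      by (simp add: c_def divide_le_eq mult.commute add_pos_pos)
    then show ?thesis by blast
  qed
  have not_null: "{y. infinite {q. y \<in> A q}} \<notin> null_sets lborel"
  proof (rule limsup_not_null[of A lborel "cbox 0 (2 *\<^sub>R One)" q0 c])
    show "cbox 0 (2 *\<^sub>R One :: 'a) \<in> fmeasurable lborel"
      by (intro fmeasurableI) (simp_all add: emeasure_lborel_cbox_finite)
    show "A q \<subseteq> cbox 0 (2 *\<^sub>R One)" if "q \<ge> q0" for q
      using coprime_nbhd_subset[of "\<delta> q" q] q0[OF that] by (force simp: A_def mem_box)
    show "c > 0" unfolding c_def by (simp add: add_pos_pos)
  qed (use A large in auto)
  \<comment> \<open>Measurability allows nullity to pass from the completed measure back to
    \<open>lborel\<close>.\<close>
  have meas: "{y. infinite {q. y \<in> A q}} \<in> sets lborel"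
  proof -
    have "{y. infinite {q. y \<in> A q}} = (\<Inter>m. \<Union>q\<in>{m..}. A q)"
      by (auto simp: infinite_nat_iff_unbounded_le)
    then show ?thesis using A by auto
  qed
  assume null: "{y :: 'a. infinite {q. q \<ge> 1 \<and> (\<forall>b\<in>Basis. near_int (\<delta> q) (real q * (y \<bullet> b)))}} \<in> null_sets lebesgue"
  have "{y. infinite {q. y \<in> A q}} \<subseteq> {y :: 'a. infinite {q. q \<ge> 1 \<and> (\<forall>b\<in>Basis. near_int (\<delta> q) (real q * (y \<bullet> b)))}}"
  proof safe
    fix y :: 'a assume "infinite {q. y \<in> A q}"
      and "finite {q. q \<ge> 1 \<and> (\<forall>b\<in>Basis. near_int (\<delta> q) (real q * (y \<bullet> b)))}"
    moreover have "{q. y \<in> A q} \<subseteq> insert 0 {q. q \<ge> 1 \<and> (\<forall>b\<in>Basis. near_int (\<delta> q) (real q * (y \<bullet> b)))}"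
      by (auto simp: A_def intro: coprime_nbhd_near_int)
    ultimately show False by (meson finite_insert finite_subset)
  qed
  then have "{y. infinite {q. y \<in> A q}} \<in> null_sets lebesgue"
    using null by (rule null_sets_completion_subset)
  with not_null meas show False
    by (simp add: null_sets_completion_iff)
qed

text \<open>At multiples of the denominator b of x the first coordinate is hit exactly. The others
  ask for q (b y) to be near integers, which is the divergence statement for z = b y and the
  function \<open>\<delta>\<close>.\<close>

lemma not_null_set_of_rational:
  fixes \<psi> :: "nat \<Rightarrow> real" and x :: real
  assumes "x \<in> \<rat>" and anti: "antimono_on {1..} \<psi>" and nonneg: "\<And>q. q \<ge> 1 \<Longrightarrow> \<psi> q \<ge> 0"
    and small: "\<forall>\<^sub>F q in sequentially. \<psi> q \<le> 1 / 2" and div: "\<not> summable (\<lambda>q. \<psi> q ^ DIM('a))"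
  shows "{y :: 'a::euclidean_space. (x, y) \<in> approximable \<psi>} \<notin> null_sets lebesgue"
proof
  let ?n = "DIM('a)"
  assume null: "{y :: 'a. (x, y) \<in> approximable \<psi>} \<in> null_sets lebesgue"
  obtain a and b0 :: int where ab0: "x = of_int a / of_int b0" "b0 > 0"
    using assms(1) by (metis Rats_cases')
  define b where "b = nat b0"
  have b: "b > 0" and xb: "real b * x = of_int a" using ab0 by (simp_all add: b_def)
  have mono: "\<psi> n \<le> \<psi> m" if "1 \<le> m" "m \<le> n" for m n
    using anti that by (auto simp: monotone_on_def)
  \<comment> \<open>\<open>near_int\<close> is strict, so exact hits count only where \<psi> is
    positive. A zero of \<psi> would persist by monotonicity and contradict divergence.\<close>
  have pos: "\<psi> q > 0" if "q \<ge> 1" for q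
  proof (rule ccontr)
    assume "\<not> \<psi> q > 0"
    with nonneg[OF that] have "\<psi> q = 0" by simp
    then have "\<psi> m = 0" if "m \<ge> q" for m
      using mono[of q m] nonneg[of m] that \<open>q \<ge> 1\<close> by simp
    then have "summable (\<lambda>m. \<psi> m ^ ?n)"
      by (intro summable_comparison_test[OF _ summable_zero] exI[of _ q]) (simp add: zero_power)
    with div show False by simp
  qed
  define \<delta> where "\<delta> q = \<psi> (b * q)" for q
  \<comment> \<open>Divergence survives the thinning: each group of b consecutive terms is at most b
    times the thinned term before it, and the first group is bounded through
    \<open>\<psi> 1\<close>.\<close>
  have "\<not> summable (\<lambda>q. \<delta> q ^ ?n)"
  proof
    assume summ: "summable (\<lambda>q. \<delta> q ^ ?n)"
    have "summable (\<lambda>q. \<psi> (Suc q) ^ ?n)"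
    proof (rule summableI_nonneg_bounded)
      show "0 \<le> \<psi> (Suc q) ^ ?n" for q using nonneg[of "Suc q"] by simp
      fix N
      have "(\<Sum>q<N. \<psi> (Suc q) ^ ?n) \<le> (\<Sum>q<N * b. \<psi> (Suc q) ^ ?n)"
        using b nonneg by (intro sum_mono2) (auto intro: less_le_trans)
      also have "\<dots> = (\<Sum>m<N. \<Sum>q\<in>{m * b..<m * b + b}. \<psi> (Suc q) ^ ?n)"
        by (rule sum.nat_group[symmetric])
      also have "\<dots> \<le> (\<Sum>m<N. real b * (if m = 0 then \<psi> 1 ^ ?n else \<delta> m ^ ?n))"
      proof (rule sum_mono)
        fix m
        have "(\<Sum>q\<in>{m * b..<m * b + b}. \<psi> (Suc q) ^ ?n) \<le> (\<Sum>q\<in>{m * b..<m * b + b}. if m = 0 then \<psi> 1 ^ ?n else \<delta> m ^ ?n)"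
          using b nonneg mono by (intro sum_mono) (auto simp: \<delta>_def mult.commute intro!: power_mono mono)
        then show "(\<Sum>q\<in>{m * b..<m * b + b}. \<psi> (Suc q) ^ ?n) \<le> real b * (if m = 0 then \<psi> 1 ^ ?n else \<delta> m ^ ?n)"
          by simp
      qed
      also have "\<dots> \<le> real b * (\<psi> 1 ^ ?n + (\<Sum>m. \<delta> (Suc m) ^ ?n))"
      proof -
        have "(\<Sum>m<N. if m = 0 then \<psi> 1 ^ ?n else \<delta> m ^ ?n) \<le> (\<Sum>m<Suc N. if m = 0 then \<psi> 1 ^ ?n else \<delta> m ^ ?n)"
          using nonneg b by (intro sum_mono2) (auto simp: \<delta>_def)
        also have "\<dots> = \<psi> 1 ^ ?n + (\<Sum>m<N. \<delta> (Suc m) ^ ?n)"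
          by (subst sum.lessThan_Suc_shift) simp
        also have "(\<Sum>m<N. \<delta> (Suc m) ^ ?n) \<le> (\<Sum>m. \<delta> (Suc m) ^ ?n)"
          using nonneg b by (intro sum_le_suminf summable_Suc_iff[THEN iffD2] summ) (auto simp: \<delta>_def summ)
        finally show ?thesis by (simp add: sum_distrib_left[symmetric] mult_left_mono)
      qed
      finally show "(\<Sum>q<N. \<psi> (Suc q) ^ ?n) \<le> real b * (\<psi> 1 ^ ?n + (\<Sum>m. \<delta> (Suc m) ^ ?n))" .
    qed
    then have "summable (\<lambda>q. \<psi> q ^ ?n)" by (subst summable_Suc_iff[symmetric])
    with div show False by simp
  qed
  then have L: "{z :: 'a. infinite {q. q \<ge> 1 \<and> (\<forall>i\<in>Basis. near_int (\<delta> q) (real q * (z \<bullet> i)))}} \<notin> null_sets lebesgue"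
    (is "?L \<notin> _")
  proof (rule khintchine_divergence[rotated 3])
    show "antimono_on {1..} \<delta>"
      using b mono by (auto simp: monotone_on_def \<delta>_def)
    show "0 \<le> \<delta> q" if "q \<ge> 1" for q using nonneg[of "b * q"] that b by (simp add: \<delta>_def)
    obtain q1 where q1: "\<And>q. q \<ge> q1 \<Longrightarrow> \<psi> q \<le> 1 / 2"
      using small by (auto simp: eventually_sequentially)
    have "\<delta> q \<le> 1 / 2" if "q \<ge> q1" for q
    proof -
      have "1 * q \<le> b * q" using b by (intro mult_right_mono) auto
      with that q1[of "b * q"] show ?thesis by (simp add: \<delta>_def)
    qed
    then show "\<forall>\<^sub>F q in sequentially. \<delta> q \<le> 1 / 2" by (auto simp: eventually_sequentially)
  qed
  \<comment> \<open>Differentiable images of null sets are null, so \<open>?L\<close> is placed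
    inside a dilated copy of the given set.\<close>
  have "?L \<subseteq> (\<lambda>y. real b *\<^sub>R y) ` {y :: 'a. (x, y) \<in> approximable \<psi>}"
  proof
    fix z :: 'a assume z: "z \<in> ?L"
    let ?y = "inverse (real b) *\<^sub>R z"
    have "infinite ((\<lambda>q. b * q) ` {q. q \<ge> 1 \<and> (\<forall>i\<in>Basis. near_int (\<delta> q) (real q * (z \<bullet> i)))})"
      using z b by (subst finite_image_iff) (auto simp: inj_on_def)
    moreover have "(\<lambda>q. b * q) ` {q. q \<ge> 1 \<and> (\<forall>i\<in>Basis. near_int (\<delta> q) (real q * (z \<bullet> i)))} \<subseteq>
      {q. q \<ge> 1 \<and> near_int (\<psi> q) (real q * x) \<and> (\<forall>i\<in>Basis. near_int (\<psi> q) (real q * (?y \<bullet> i)))}"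
    proof clarify
      fix q assume q: "q \<ge> 1" "\<forall>i\<in>Basis. near_int (\<delta> q) (real q * (z \<bullet> i))"
      have bq: "b * q \<ge> 1" using b q(1) by simp
      have "real (b * q) * x = real q * (real b * x)" by simp
      also have "\<dots> = of_int (int q * a)" by (simp add: xb)
      finally have eq: "real (b * q) * x = of_int (int q * a)" .
      then have "near_int (\<psi> (b * q)) (real (b * q) * x)"
        using pos[OF bq] unfolding near_int_def eq by (intro exI[of _ "int q * a"]) simp
      moreover have "real (b * q) * (?y \<bullet> i) = real q * (z \<bullet> i)" for i
        using b by simp
      ultimately show "b * q \<ge> 1 \<and> near_int (\<psi> (b * q)) (real (b * q) * x) \<and>
          (\<forall>i\<in>Basis. near_int (\<psi> (b * q)) (real (b * q) * (?y \<bullet> i)))"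
        using bq q(2) by (simp only: \<delta>_def)
    qed
    ultimately have "(x, ?y) \<in> approximable \<psi>"
      unfolding approximable_Pair_iff using finite_subset by blast
    moreover have "z = real b *\<^sub>R ?y" using b by simp
    ultimately show "z \<in> (\<lambda>y. real b *\<^sub>R y) ` {y :: 'a. (x, y) \<in> approximable \<psi>}" by blast
  qed
  moreover have "negligible ((\<lambda>y. real b *\<^sub>R y) ` {y :: 'a. (x, y) \<in> approximable \<psi>})"
    using null by (intro negligible_differentiable_image_negligible)
      (auto simp: negligible_iff_null_sets differentiable_on_def intro!: derivative_intros)
  ultimately have "negligible ?L" by (rule negligible_subset[rotated])
  with L show False by (simp add: negligible_iff_null_sets)
qed


theorem theorem5:
  fixes d :: nat and \<psi> :: "nat \<Rightarrow> real"
  assumes "d \<ge> 2" and "CARD('n::finite) = d - 1"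
    and "\<And>q. q \<ge> 1 \<Longrightarrow> \<psi> q \<ge> 0"
    and "antimono_on {1..} \<psi>"
    and "summable (\<lambda>q. \<psi> q ^ d)"
  shows
    "(\<not> summable (\<lambda>q. \<psi> q ^ (d - 1)) \<longrightarrow>
        (\<forall>x\<in>(\<rat> :: real set). {y :: real ^ 'n. (x, y) \<in> approximable \<psi>} \<notin> null_sets lebesgue))
     \<and> (summable (\<lambda>q. \<psi> q ^ (d - 1)) \<longrightarrow>
        (\<forall>x::real. {y :: real ^ 'n. (x, y) \<in> approximable \<psi>} \<in> null_sets lebesgue))
     \<and> (\<forall>x::real. x \<notin> \<rat> \<and> bounded_ratio x \<longrightarrow>
        {y :: real ^ 'n. (x, y) \<in> approximable \<psi>} \<in> null_sets lebesgue)
     \<and> (\<forall>x::real. diophantine_type x < ereal ((1 + sqrt 5) / 2) \<longrightarrow> x \<notin> \<rat> \<and> bounded_ratio x)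
     \<and> (\<forall>x::real. diophantine_type x < 2 \<and>
          (\<exists>R\<ge>1. infinite (large_indices x R) \<longrightarrow>
            (\<forall>\<^sub>F m in sequentially.
              continuant x (large_index x R m) \<ge> 2 * continuant x (large_index x R (m - 1) + 1)))
        \<longrightarrow> x \<notin> \<rat> \<and> bounded_ratio x)"
proof -
  have dim: "DIM(real ^ 'n) = d - 1" using assms(2) by simp
  have d: "d = Suc (d - 1)" "d - 1 \<ge> 1" using assms(1) by simp_all
  \<comment> \<open>Convergence of the d-th powers forces \<psi> to 0; the bound 1 / 2 keeps the
    intervals about reduced fractions disjoint.\<close>
  have small: "\<forall>\<^sub>F q in sequentially. \<psi> q \<le> 1 / 2"
  proof -
    have "\<forall>\<^sub>F q in sequentially. \<psi> q ^ d < (1 / 2) ^ d"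
      by (rule order_tendstoD(2)[OF summable_LIMSEQ_zero[OF assms(5)]]) simp
    then show ?thesis
      by eventually_elim (metis less_imp_le power_less_imp_less_base zero_le_divide_1_iff zero_le_numeral)
  qed
  have rational: "{y :: real ^ 'n. (x, y) \<in> approximable \<psi>} \<notin> null_sets lebesgue"
    if "\<not> summable (\<lambda>q. \<psi> q ^ (d - 1))" "x \<in> \<rat>" for x :: real
    by (rule not_null_set_of_rational[OF that(2) assms(4,3) small]) (simp_all only: dim that(1) not_False_eq_True)
  have convergent: "{y :: real ^ 'n. (x, y) \<in> approximable \<psi>} \<in> null_sets lebesgue"
    if "summable (\<lambda>q. \<psi> q ^ (d - 1))" for x :: real
  proof (rule null_set_of_summable[OF assms(3)])
    have "\<forall>\<^sub>F q in sequentially. norm (if near_int (\<psi> q) (real q * x) then \<psi> q ^ (d - 1) else 0) \<le> \<psi> q ^ (d - 1)"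
      using eventually_ge_at_top[of 1] by eventually_elim (simp add: assms(3))
    then show "summable (\<lambda>q. if near_int (\<psi> q) (real q * x) then \<psi> q ^ DIM(real ^ 'n) else 0)"
      unfolding dim by (rule summable_comparison_test_ev[OF _ that])
  qed
  have ratio: "{y :: real ^ 'n. (x, y) \<in> approximable \<psi>} \<in> null_sets lebesgue"
    if "x \<notin> \<rat>" "bounded_ratio x" for x :: real
  proof (rule null_set_of_summable[OF assms(3)])
    have "summable (\<lambda>q. \<psi> q ^ Suc (d - 1))" using assms(5) d(1) by simp
    then show "summable (\<lambda>q. if near_int (\<psi> q) (real q * x) then \<psi> q ^ DIM(real ^ 'n) else 0)"
      unfolding dim using that assms(3,4) d(2)
      by (intro summable_near_term bounded_ratio_imp_summable_growth)
  qed
  have irrational: "x \<notin> \<rat>" if "diophantine_type x < 2" for x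
    using diophantine_type_less_imp_irrational[of x 2] that unfolding numeral_eq_ereal .
  show ?thesis
  proof (intro conjI impI allI ballI)
    fix x :: real
    assume "diophantine_type x < ereal ((1 + sqrt 5) / 2)"
    then show "x \<notin> \<rat>" "bounded_ratio x"
      by (rule diophantine_type_less_imp_irrational, rule bounded_ratio_of_type_less_golden)
  next
    fix x :: real
    assume *: "diophantine_type x < 2 \<and>
          (\<exists>R\<ge>1. infinite (large_indices x R) \<longrightarrow>
            (\<forall>\<^sub>F m in sequentially.
              continuant x (large_index x R m) \<ge> 2 * continuant x (large_index x R (m - 1) + 1)))"
    then show "x \<notin> \<rat>" by (elim conjE) (rule irrational)
    from * show "bounded_ratio x"
      by (elim conjE exE) (rule bounded_ratio_of_type_less_2, assumption+, rule mp)
  qed (rule rational convergent, assumption+ | (elim conjE, rule ratio, assumption+))+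
qed

end
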